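(* Let $M$ be a manifold endowed with a metric contact pair $(\alpha_1,\alpha_2,\phi,g)$ with decomposable $\phi$. Then the characteristic foliations $\mathcal F_1$ and $\mathcal F_2$ of $\alpha_1$ and $\alpha_2$ are minimal with respect to $g$.
   Context: All objects are smooth. Contact pair: a pair $(\alpha_1,\alpha_2)$ of $1$-forms on a manifold $M$ (of dimension $2h+2k+2$) is a contact pair of type $(h,k)$ if $\alpha_1\wedge(d\alpha_1)^h\wedge\alpha_2\wedge(d\alpha_2)^k$ is a volume form, $(d\alpha_1)^{h+1}=0$ and $(d\alpha_2)^{k+1}=0$. Characteristic foliations: for $i=1,2$ the distribution $T\mathcal F_i=\ker\alpha_i\cap\ker d\alpha_i$ (where $\ker d\alpha_i=\{X: i_Xd\alpha_i=0\}$) is completely integrable and determines the characteristic foliation $\mathcal F_i$ of $\alpha_i$. One has $TM=T\mathcal F_1\oplus T\mathcal F_2$, with $\dim\mathcal F_1=2k+1$ and $\dim\mathcal F_2=2h+1$. Reeb vector fields: $Z_1,Z_2$ are the unique vector fields with $\alpha_1(Z_1)=\alpha_2(Z_2)=1$, $\alpha_1(Z_2)=\alpha_2(Z_1)=0$, and $i_{Z_i}d\alpha_j=0$ for all $i,j\in\{1,2\}$. Contact pair structure: a triple $(\alpha_1,\alpha_2,\phi)$ where $(\alpha_1,\alpha_2)$ is a contact pair and $\phi$ is a $(1,1)$-tensor field with $\phi^2=-\mathrm{Id}+\alpha_1\otimes Z_1+\alpha_2\otimes Z_2$ and $\phi(Z_1)=\phi(Z_2)=0$. Metric contact pair (MCP):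 a quadruple $(\alpha_1,\alpha_2,\phi,g)$ where $(\alpha_1,\alpha_2,\phi)$ is a contact pair structure and $g$ is an associated metric, i.e. a Riemannian metric with $g(X,\phi Y)=(d\alpha_1+d\alpha_2)(X,Y)$ and $g(X,Z_i)=\alpha_i(X)$, $i=1,2$, for all vector fields $X,Y$. Convention: for a $1$-form $\alpha$, $d\alpha(X,Y)=\tfrac12\big(X\alpha(Y)-Y\alpha(X)-\alpha([X,Y])\big)$. Decomposable: $\phi$ is decomposable if $\phi(T\mathcal F_i)\subset T\mathcal F_i$ for $i=1,2$. A foliation on a Riemannian manifold is minimal if each of its leaves is a minimal (immersed) submanifold, i.e. has identically vanishing mean curvature vector. *)

theory Defs
  imports "HOL-Analysis.Analysis" "HOL-Combinatorics.Permutations"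
begin

section \<open>Smooth maps\<close>

abbreviation ddir :: "('a::real_normed_vector \<Rightarrow> 'b::real_normed_vector) \<Rightarrow> 'a \<Rightarrow> 'a \<Rightarrow> 'b" where
  "ddir f x \<equiv> frechet_derivative f (at x)"

primrec times_differentiable_on ::
  "nat \<Rightarrow> 'a::real_normed_vector set \<Rightarrow> ('a \<Rightarrow> 'b::real_normed_vector) \<Rightarrow> bool" where
  "times_differentiable_on 0 S f \<longleftrightarrow> continuous_on S f"
| "times_differentiable_on (Suc n) S f \<longleftrightarrow>
     (\<forall>x\<in>S. f differentiable at x) \<and> (\<forall>v. times_differentiable_on n S (\<lambda>x. ddir f x v))"

text \<open>Only used for open \<open>S\<close> and finite-dimensional spaces.\<close>

definition smooth_on :: "'a::real_normed_vector set \<Rightarrow> ('a \<Rightarrow> 'b::real_normed_vector) \<Rightarrow> bool" where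
  "smooth_on S f \<longleftrightarrow> (\<forall>n. times_differentiable_on n S f)"

lemma smooth_on_imp_differentiable:
  assumes "smooth_on S f" and "x \<in> S"
  shows "f differentiable at x"
proof -
  have "times_differentiable_on (Suc 0) S f"
    using assms(1) unfolding smooth_on_def by blast
  then show ?thesis using assms(2) by simp
qed


section \<open>Smooth manifolds\<close>

text \<open>
  A chart is a pair of its domain and its coordinate map; the latter is only meaningful on the domain.
  A manifold is given by an atlas, which determines both the point set and the topology.
  This allows a subset of a manifold to carry a manifold structure of its own, with a topology
  finer than the induced one, as leaves of foliations do.
\<close>

type_synonym ('p, 'e) chart = "'p set \<times> ('p \<Rightarrow> 'e)"

definition chart_image :: "('p, 'e) chart \<Rightarrow> 'e set" where
  "chart_image c = snd c ` fst c"

definition overlap :: "('p, 'f) chart \<Rightarrow> ('p, 'e) chart \<Rightarrow> 'f set" where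
  "overlap b c = snd b ` (fst b \<inter> fst c)"

text \<open>
  If \<open>b\<close> and \<open>c\<close> are charts of the same manifold, this is the change of coordinates. If \<open>b\<close> is a
  chart of a subset with its own manifold structure, it is the inclusion read in the two charts.
\<close>

definition transition :: "('p, 'f) chart \<Rightarrow> ('p, 'e) chart \<Rightarrow> 'f \<Rightarrow> 'e" where
  "transition b c = snd c \<circ> inv_into (fst b) (snd b)"

definition manifold_points :: "('p, 'e) chart set \<Rightarrow> 'p set" where
  "manifold_points A = (\<Union>c\<in>A. fst c)"

definition manifold_topology :: "('p, 'e::euclidean_space) chart set \<Rightarrow> 'p topology" where
  "manifold_topology A =
     topology (\<lambda>U. U \<subseteq> manifold_points A \<and> (\<forall>c\<in>A. open (snd c ` (U \<inter> fst c))))"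

definition smooth_atlas :: "('p, 'e::euclidean_space) chart set \<Rightarrow> bool" where
  "smooth_atlas A \<longleftrightarrow>
     (\<forall>c\<in>A. inj_on (snd c) (fst c) \<and> open (chart_image c)) \<and>
     (\<forall>c\<in>A. \<forall>c'\<in>A. open (overlap c c') \<and> smooth_on (overlap c c') (transition c c'))"

lemma openin_manifold_topology:
  assumes "smooth_atlas A"
  shows "openin (manifold_topology A) U \<longleftrightarrow>
           U \<subseteq> manifold_points A \<and> (\<forall>c\<in>A. open (snd c ` (U \<inter> fst c)))"
proof -
  have "istopology (\<lambda>U. U \<subseteq> manifold_points A \<and> (\<forall>c\<in>A. open (snd c ` (U \<inter> fst c))))"
    unfolding istopology_def
  proof (intro conjI allI impI ballI)
    fix S T c
    assume S: "S \<subseteq> manifold_points A \<and> (\<forall>c\<in>A. open (snd c ` (S \<inter> fst c)))"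
      and T: "T \<subseteq> manifold_points A \<and> (\<forall>c\<in>A. open (snd c ` (T \<inter> fst c)))"
      and c: "c \<in> A"
    have "inj_on (snd c) (fst c)"
      using assms c by (auto simp: smooth_atlas_def)
    then have "snd c ` ((S \<inter> fst c) \<inter> (T \<inter> fst c)) = snd c ` (S \<inter> fst c) \<inter> snd c ` (T \<inter> fst c)"
      by (rule inj_on_image_Int) auto
    moreover have "S \<inter> T \<inter> fst c = (S \<inter> fst c) \<inter> (T \<inter> fst c)" by auto
    ultimately show "open (snd c ` (S \<inter> T \<inter> fst c))"
      using S T c by auto
  next
    fix \<K> c
    assume K: "\<forall>K\<in>\<K>. K \<subseteq> manifold_points A \<and> (\<forall>c\<in>A. open (snd c ` (K \<inter> fst c)))"
      and c: "c \<in> A"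
    have "snd c ` (\<Union>\<K> \<inter> fst c) = (\<Union>K\<in>\<K>. snd c ` (K \<inter> fst c))" by auto
    then show "open (snd c ` (\<Union>\<K> \<inter> fst c))"
      using K c by auto
  qed auto
  then show ?thesis
    by (simp add: manifold_topology_def topology_inverse')
qed

definition smooth_manifold :: "('p, 'e::euclidean_space) chart set \<Rightarrow> bool" where
  "smooth_manifold A \<longleftrightarrow>
     smooth_atlas A \<and> Hausdorff_space (manifold_topology A) \<and> second_countable (manifold_topology A)"


section \<open>Tensor fields\<close>

text \<open>
  A tensor field is given by its components in the charts of an atlas, as functions of the
  coordinates, subject to smoothness and to the transformation rule under changes of coordinates.
  A tangent vector at a point is thus represented, in a chart around that point, by its components,
  and statements about all tangent vectors at all points are made chart by chart.
  Values outside the chart images and for charts outside the atlas are irrelevant.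
\<close>

type_synonym ('p, 'e) vector_field = "('p, 'e) chart \<Rightarrow> 'e \<Rightarrow> 'e"
type_synonym ('p, 'e) one_form = "('p, 'e) chart \<Rightarrow> 'e \<Rightarrow> 'e \<Rightarrow> real"
type_synonym ('p, 'e) two_tensor = "('p, 'e) chart \<Rightarrow> 'e \<Rightarrow> 'e \<Rightarrow> 'e \<Rightarrow> real"
type_synonym ('p, 'e) endomorphism_field = "('p, 'e) chart \<Rightarrow> 'e \<Rightarrow> 'e \<Rightarrow> 'e"
type_synonym ('p, 'e) distribution = "('p, 'e) chart \<Rightarrow> 'e \<Rightarrow> 'e set"

definition smooth_vector_field ::
  "('p, 'e::euclidean_space) chart set \<Rightarrow> ('p, 'e) vector_field \<Rightarrow> bool" where
  "smooth_vector_field A X \<longleftrightarrow>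
     (\<forall>c\<in>A. smooth_on (chart_image c) (X c)) \<and>
     (\<forall>c\<in>A. \<forall>c'\<in>A. \<forall>x\<in>overlap c c'.
        X c' (transition c c' x) = ddir (transition c c') x (X c x))"

definition smooth_one_form ::
  "('p, 'e::euclidean_space) chart set \<Rightarrow> ('p, 'e) one_form \<Rightarrow> bool" where
  "smooth_one_form A \<alpha> \<longleftrightarrow>
     (\<forall>c\<in>A. \<forall>x\<in>chart_image c. linear (\<alpha> c x)) \<and>
     (\<forall>c\<in>A. \<forall>v. smooth_on (chart_image c) (\<lambda>x. \<alpha> c x v)) \<and>
     (\<forall>c\<in>A. \<forall>c'\<in>A. \<forall>x\<in>overlap c c'. \<forall>v.
        \<alpha> c' (transition c c' x) (ddir (transition c c') x v) = \<alpha> c x v)"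

definition smooth_endomorphism_field ::
  "('p, 'e::euclidean_space) chart set \<Rightarrow> ('p, 'e) endomorphism_field \<Rightarrow> bool" where
  "smooth_endomorphism_field A \<phi> \<longleftrightarrow>
     (\<forall>c\<in>A. \<forall>x\<in>chart_image c. linear (\<phi> c x)) \<and>
     (\<forall>c\<in>A. \<forall>v. smooth_on (chart_image c) (\<lambda>x. \<phi> c x v)) \<and>
     (\<forall>c\<in>A. \<forall>c'\<in>A. \<forall>x\<in>overlap c c'. \<forall>v.
        \<phi> c' (transition c c' x) (ddir (transition c c') x v) = ddir (transition c c') x (\<phi> c x v))"

definition inner_product :: "('v::euclidean_space \<Rightarrow> 'v \<Rightarrow> real) \<Rightarrow> bool" where
  "inner_product h \<longleftrightarrow> bilinear h \<and> (\<forall>u v. h u v = h v u) \<and> (\<forall>v. v \<noteq> 0 \<longrightarrow> h v v > 0)"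

definition riemannian_metric ::
  "('p, 'e::euclidean_space) chart set \<Rightarrow> ('p, 'e) two_tensor \<Rightarrow> bool" where
  "riemannian_metric A g \<longleftrightarrow>
     (\<forall>c\<in>A. \<forall>x\<in>chart_image c. inner_product (g c x)) \<and>
     (\<forall>c\<in>A. \<forall>u v. smooth_on (chart_image c) (\<lambda>x. g c x u v)) \<and>
     (\<forall>c\<in>A. \<forall>c'\<in>A. \<forall>x\<in>overlap c c'. \<forall>u v.
        g c' (transition c c' x) (ddir (transition c c') x u) (ddir (transition c c') x v) = g c x u v)"


section \<open>Exterior calculus\<close>

text \<open>
  The convention is \<open>d\<alpha>(X,Y) = (X \<alpha>(Y) - Y \<alpha>(X) - \<alpha>([X,Y])) / 2\<close>. The definition takes \<open>X\<close> and \<open>Y\<close>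
  with constant components in the chart, for which the bracket vanishes;
  the lemma \<open>ext_deriv_vector_fields\<close> gives the formula for arbitrary vector fields.
\<close>

definition ext_deriv :: "('p, 'e::euclidean_space) one_form \<Rightarrow> ('p, 'e) two_tensor" where
  "ext_deriv \<alpha> c x u v = (ddir (\<lambda>y. \<alpha> c y v) x u - ddir (\<lambda>y. \<alpha> c y u) x v) / 2"

definition lie_bracket ::
  "('p, 'e::euclidean_space) vector_field \<Rightarrow> ('p, 'e) vector_field \<Rightarrow> ('p, 'e) vector_field" where
  "lie_bracket X Y c x = ddir (Y c) x (X c x) - ddir (X c) x (Y c x)"

lemma ddir_form_apply:
  fixes a :: "'e::euclidean_space \<Rightarrow> 'e \<Rightarrow> real"
  assumes S: "open S" "x \<in> S" and lin: "\<And>y. y \<in> S \<Longrightarrow> linear (a y)"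
    and a: "\<And>v. (\<lambda>y. a y v) differentiable at x" and Y: "Y differentiable at x"
  shows "ddir (\<lambda>y. a y (Y y)) x u = ddir (\<lambda>y. a y (Y x)) x u + a x (ddir Y x u)"
proof -
  have expand: "a y w = (\<Sum>i\<in>Basis. (w \<bullet> i) * a y i)" if "y \<in> S" for y w
  proof -
    have "a y w = a y (\<Sum>i\<in>Basis. (w \<bullet> i) *\<^sub>R i)" by (simp add: euclidean_representation)
    also have "\<dots> = (\<Sum>i\<in>Basis. (w \<bullet> i) * a y i)"
      using lin[OF that] by (simp add: linear_sum linear_cmul)
    finally show ?thesis .
  qed
  have da: "((\<lambda>y. a y v) has_derivative ddir (\<lambda>y. a y v) x) (at x)" for v
    using a frechet_derivative_works by blast
  have dY: "(Y has_derivative ddir Y x) (at x)"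
    using Y frechet_derivative_works by blast
  have *: "((\<lambda>y. a y (W y)) has_derivative
       (\<lambda>u. \<Sum>i\<in>Basis. (W x \<bullet> i) * ddir (\<lambda>y. a y i) x u + (W' u \<bullet> i) * a x i)) (at x)"
    if W: "(W has_derivative W') (at x)" for W W'
  proof -
    have "((\<lambda>y. \<Sum>i\<in>Basis. (W y \<bullet> i) * a y i) has_derivative
       (\<lambda>u. \<Sum>i\<in>Basis. (W x \<bullet> i) * ddir (\<lambda>y. a y i) x u + (W' u \<bullet> i) * a x i)) (at x)"
      by (intro has_derivative_sum has_derivative_mult has_derivative_inner_left W da)
    then show ?thesis
      by (rule has_derivative_transform_within_open[OF _ S]) (metis expand)
  qed
  have "ddir (\<lambda>y. a y (Y y)) x u =
      (\<Sum>i\<in>Basis. (Y x \<bullet> i) * ddir (\<lambda>y. a y i) x u + (ddir Y x u \<bullet> i) * a x i)"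
    by (simp add: frechet_derivative_at[OF *[OF dY], symmetric])
  moreover have "ddir (\<lambda>y. a y (Y x)) x u = (\<Sum>i\<in>Basis. (Y x \<bullet> i) * ddir (\<lambda>y. a y i) x u)"
    by (simp add: frechet_derivative_at[OF *[OF has_derivative_const[of "Y x"]], symmetric])
  moreover have "a x (ddir Y x u) = (\<Sum>i\<in>Basis. (ddir Y x u \<bullet> i) * a x i)"
    using expand S(2) by blast
  ultimately show ?thesis by (simp add: sum.distrib)
qed

lemma ext_deriv_vector_fields:
  assumes A: "smooth_atlas A" "c \<in> A" "x \<in> chart_image c" and \<alpha>: "smooth_one_form A \<alpha>"
    and X: "smooth_vector_field A X" and Y: "smooth_vector_field A Y"
  shows "ext_deriv \<alpha> c x (X c x) (Y c x) =
    (ddir (\<lambda>y. \<alpha> c y (Y c y)) x (X c x) - ddir (\<lambda>y. \<alpha> c y (X c y)) x (Y c x)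
       - \<alpha> c x (lie_bracket X Y c x)) / 2"
proof -
  have S: "open (chart_image c)" using A by (auto simp: smooth_atlas_def)
  have lin: "\<And>y. y \<in> chart_image c \<Longrightarrow> linear (\<alpha> c y)"
    using \<alpha> A(2) by (simp add: smooth_one_form_def)
  have "smooth_on (chart_image c) (\<lambda>y. \<alpha> c y v)" for v
    using \<alpha> A(2) by (simp add: smooth_one_form_def)
  then have da: "(\<lambda>y. \<alpha> c y v) differentiable at x" for v
    by (rule smooth_on_imp_differentiable[OF _ A(3)])
  have "smooth_on (chart_image c) (X c)" "smooth_on (chart_image c) (Y c)"
    using X Y A(2) by (simp_all add: smooth_vector_field_def)
  then have dX: "X c differentiable at x" and dY: "Y c differentiable at x"
    using A(3) by (auto intro: smooth_on_imp_differentiable)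
  show ?thesis
    using ddir_form_apply[OF S A(3) lin da dX] ddir_form_apply[OF S A(3) lin da dY] lin[OF A(3)]
    by (simp add: ext_deriv_def lie_bracket_def linear_diff)
qed

text \<open>
  An alternating form of degree \<open>p\<close> on a vector space is a function of sequences of vectors that
  depends on the first \<open>p\<close> entries. The normalisation of the wedge product is the one that goes with
  the factor \<open>1/2\<close> in the exterior derivative.
\<close>

definition wedge ::
  "nat \<Rightarrow> nat \<Rightarrow> ((nat \<Rightarrow> 'e) \<Rightarrow> real) \<Rightarrow> ((nat \<Rightarrow> 'e) \<Rightarrow> real) \<Rightarrow> (nat \<Rightarrow> 'e) \<Rightarrow> real" where
  "wedge p q \<omega> \<eta> v =
     (\<Sum>\<pi> | \<pi> permutes {..<p + q}. of_int (sign \<pi>) * \<omega> (\<lambda>i. v (\<pi> i)) * \<eta> (\<lambda>i. v (\<pi> (p + i))))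
       / fact (p + q)"

primrec two_form_power :: "((nat \<Rightarrow> 'e) \<Rightarrow> real) \<Rightarrow> nat \<Rightarrow> (nat \<Rightarrow> 'e) \<Rightarrow> real" where
  "two_form_power \<omega> 0 = (\<lambda>v. 1)"
| "two_form_power \<omega> (Suc n) = wedge 2 (2 * n) \<omega> (two_form_power \<omega> n)"

definition form1 :: "('e \<Rightarrow> real) \<Rightarrow> (nat \<Rightarrow> 'e) \<Rightarrow> real" where
  "form1 a = (\<lambda>v. a (v 0))"

definition form2 :: "('e \<Rightarrow> 'e \<Rightarrow> real) \<Rightarrow> (nat \<Rightarrow> 'e) \<Rightarrow> real" where
  "form2 b = (\<lambda>v. b (v 0) (v 1))"


section \<open>Metric contact pairs\<close>

text \<open>A top-degree form is a volume form if it vanishes at no point.\<close>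

definition contact_pair ::
  "('p, 'e::euclidean_space) chart set \<Rightarrow> nat \<Rightarrow> nat \<Rightarrow> ('p, 'e) one_form \<Rightarrow> ('p, 'e) one_form \<Rightarrow> bool" where
  "contact_pair A h k \<alpha>\<^sub>1 \<alpha>\<^sub>2 \<longleftrightarrow>
     DIM('e) = 2 * h + 2 * k + 2 \<and> smooth_one_form A \<alpha>\<^sub>1 \<and> smooth_one_form A \<alpha>\<^sub>2 \<and>
     (\<forall>c\<in>A. \<forall>x\<in>chart_image c.
        (\<exists>v. wedge (2 * h + 1) (2 * k + 1)
               (wedge 1 (2 * h) (form1 (\<alpha>\<^sub>1 c x)) (two_form_power (form2 (ext_deriv \<alpha>\<^sub>1 c x)) h))
               (wedge 1 (2 * k) (form1 (\<alpha>\<^sub>2 c x)) (two_form_power (form2 (ext_deriv \<alpha>\<^sub>2 c x)) k)) v \<noteq> 0) \<and>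
        (\<forall>v. two_form_power (form2 (ext_deriv \<alpha>\<^sub>1 c x)) (h + 1) v = 0) \<and>
        (\<forall>v. two_form_power (form2 (ext_deriv \<alpha>\<^sub>2 c x)) (k + 1) v = 0))"

definition reeb_fields ::
  "('p, 'e::euclidean_space) chart set \<Rightarrow> ('p, 'e) one_form \<Rightarrow> ('p, 'e) one_form
     \<Rightarrow> ('p, 'e) vector_field \<Rightarrow> ('p, 'e) vector_field \<Rightarrow> bool" where
  "reeb_fields A \<alpha>\<^sub>1 \<alpha>\<^sub>2 Z\<^sub>1 Z\<^sub>2 \<longleftrightarrow>
     smooth_vector_field A Z\<^sub>1 \<and> smooth_vector_field A Z\<^sub>2 \<and>
     (\<forall>c\<in>A. \<forall>x\<in>chart_image c.
        \<alpha>\<^sub>1 c x (Z\<^sub>1 c x) = 1 \<and> \<alpha>\<^sub>2 c x (Z\<^sub>2 c x) = 1 \<and>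
        \<alpha>\<^sub>1 c x (Z\<^sub>2 c x) = 0 \<and> \<alpha>\<^sub>2 c x (Z\<^sub>1 c x) = 0 \<and>
        (\<forall>v. ext_deriv \<alpha>\<^sub>1 c x (Z\<^sub>1 c x) v = 0 \<and> ext_deriv \<alpha>\<^sub>2 c x (Z\<^sub>1 c x) v = 0 \<and>
             ext_deriv \<alpha>\<^sub>1 c x (Z\<^sub>2 c x) v = 0 \<and> ext_deriv \<alpha>\<^sub>2 c x (Z\<^sub>2 c x) v = 0))"

text \<open>
  The Reeb fields are determined by the contact pair (on the chart images), so they are not part of
  the data of the structures below; they appear as parameters only to give them names.
\<close>

definition contact_pair_structure ::
  "('p, 'e::euclidean_space) chart set \<Rightarrow> nat \<Rightarrow> nat \<Rightarrow> ('p, 'e) one_form \<Rightarrow> ('p, 'e) one_form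
     \<Rightarrow> ('p, 'e) vector_field \<Rightarrow> ('p, 'e) vector_field \<Rightarrow> ('p, 'e) endomorphism_field \<Rightarrow> bool" where
  "contact_pair_structure A h k \<alpha>\<^sub>1 \<alpha>\<^sub>2 Z\<^sub>1 Z\<^sub>2 \<phi> \<longleftrightarrow>
     contact_pair A h k \<alpha>\<^sub>1 \<alpha>\<^sub>2 \<and> reeb_fields A \<alpha>\<^sub>1 \<alpha>\<^sub>2 Z\<^sub>1 Z\<^sub>2 \<and> smooth_endomorphism_field A \<phi> \<and>
     (\<forall>c\<in>A. \<forall>x\<in>chart_image c.
        (\<forall>v. \<phi> c x (\<phi> c x v) = - v + \<alpha>\<^sub>1 c x v *\<^sub>R Z\<^sub>1 c x + \<alpha>\<^sub>2 c x v *\<^sub>R Z\<^sub>2 c x) \<and>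
        \<phi> c x (Z\<^sub>1 c x) = 0 \<and> \<phi> c x (Z\<^sub>2 c x) = 0)"

definition metric_contact_pair ::
  "('p, 'e::euclidean_space) chart set \<Rightarrow> nat \<Rightarrow> nat \<Rightarrow> ('p, 'e) one_form \<Rightarrow> ('p, 'e) one_form
     \<Rightarrow> ('p, 'e) vector_field \<Rightarrow> ('p, 'e) vector_field \<Rightarrow> ('p, 'e) endomorphism_field
     \<Rightarrow> ('p, 'e) two_tensor \<Rightarrow> bool" where
  "metric_contact_pair A h k \<alpha>\<^sub>1 \<alpha>\<^sub>2 Z\<^sub>1 Z\<^sub>2 \<phi> g \<longleftrightarrow>
     contact_pair_structure A h k \<alpha>\<^sub>1 \<alpha>\<^sub>2 Z\<^sub>1 Z\<^sub>2 \<phi> \<and> riemannian_metric A g \<and>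
     (\<forall>c\<in>A. \<forall>x\<in>chart_image c.
        (\<forall>u v. g c x u (\<phi> c x v) = ext_deriv \<alpha>\<^sub>1 c x u v + ext_deriv \<alpha>\<^sub>2 c x u v) \<and>
        (\<forall>u. g c x u (Z\<^sub>1 c x) = \<alpha>\<^sub>1 c x u \<and> g c x u (Z\<^sub>2 c x) = \<alpha>\<^sub>2 c x u))"

definition characteristic_distribution ::
  "('p, 'e::euclidean_space) one_form \<Rightarrow> ('p, 'e) distribution" where
  "characteristic_distribution \<alpha> c x = {v. \<alpha> c x v = 0 \<and> (\<forall>w. ext_deriv \<alpha> c x v w = 0)}"

definition decomposable ::
  "('p, 'e::euclidean_space) chart set \<Rightarrow> ('p, 'e) one_form \<Rightarrow> ('p, 'e) one_form
     \<Rightarrow> ('p, 'e) endomorphism_field \<Rightarrow> bool" where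
  "decomposable A \<alpha>\<^sub>1 \<alpha>\<^sub>2 \<phi> \<longleftrightarrow>
     (\<forall>c\<in>A. \<forall>x\<in>chart_image c.
        \<phi> c x ` characteristic_distribution \<alpha>\<^sub>1 c x \<subseteq> characteristic_distribution \<alpha>\<^sub>1 c x \<and>
        \<phi> c x ` characteristic_distribution \<alpha>\<^sub>2 c x \<subseteq> characteristic_distribution \<alpha>\<^sub>2 c x)"


section \<open>Immersed submanifolds and leaves\<close>

text \<open>
  \<open>A\<close> is the atlas of the ambient manifold and \<open>B\<close> the atlas of the submanifold, whose
  points are points of the ambient manifold; the inclusion has to be an immersion.
\<close>

definition immersed_submanifold ::
  "('p, 'e::euclidean_space) chart set \<Rightarrow> ('p, 'f::euclidean_space) chart set \<Rightarrow> bool" where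
  "immersed_submanifold A B \<longleftrightarrow>
     smooth_manifold B \<and> manifold_points B \<subseteq> manifold_points A \<and>
     (\<forall>b\<in>B. \<forall>c\<in>A. open (overlap b c) \<and> smooth_on (overlap b c) (transition b c) \<and>
        (\<forall>y\<in>overlap b c. inj (ddir (transition b c) y)))"

definition connected_integral_manifold ::
  "('p, 'e::euclidean_space) chart set \<Rightarrow> ('p, 'e) distribution
     \<Rightarrow> ('p, 'f::euclidean_space) chart set \<Rightarrow> bool" where
  "connected_integral_manifold A D B \<longleftrightarrow>
     immersed_submanifold A B \<and> manifold_points B \<noteq> {} \<and> connected_space (manifold_topology B) \<and>
     (\<forall>b\<in>B. \<forall>c\<in>A. \<forall>y\<in>overlap b c. range (ddir (transition b c) y) = D c (transition b c y))"

definition leaf ::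
  "('p, 'e::euclidean_space) chart set \<Rightarrow> ('p, 'e) distribution
     \<Rightarrow> ('p, 'f::euclidean_space) chart set \<Rightarrow> bool" where
  "leaf A D B \<longleftrightarrow>
     connected_integral_manifold A D B \<and>
     (\<forall>B' :: ('p, 'f) chart set. connected_integral_manifold A D B' \<longrightarrow>
        manifold_points B \<subseteq> manifold_points B' \<longrightarrow> manifold_points B' = manifold_points B)"

text \<open>
  A foliation is represented by its set of leaves, each with its manifold structure. The model space
  \<open>'f\<close> of the leaves is an arbitrary Euclidean space; a distribution of
  rank \<open>r\<close> can only have leaves if \<open>DIM('f) = r\<close>.
\<close>

definition characteristic_foliation ::
  "('p, 'e::euclidean_space) chart set \<Rightarrow> ('p, 'e) one_form \<Rightarrow> ('p, 'f::euclidean_space) chart set set" where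
  "characteristic_foliation A \<alpha> = {B. leaf A (characteristic_distribution \<alpha>) B}"


section \<open>Mean curvature\<close>

definition orthonormal_basis ::
  "('v::euclidean_space \<Rightarrow> 'v \<Rightarrow> real) \<Rightarrow> 'v set \<Rightarrow> bool" where
  "orthonormal_basis h E \<longleftrightarrow>
     finite E \<and> span E = UNIV \<and> (\<forall>u\<in>E. \<forall>v\<in>E. h u v = (if u = v then 1 else 0))"

lemma orthonormal_basis_exists:
  assumes h: "inner_product h"
  shows "\<exists>E. orthonormal_basis h E"
proof -
  have bil: "bilinear h" and sym: "\<And>u v. h u v = h v u" and pos: "\<And>v. v \<noteq> 0 \<Longrightarrow> h v v > 0"
    using h by (auto simp: inner_product_def)
  have linl: "linear (\<lambda>u. h u v)" and linr: "linear (h v)" for v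
    using bil by (auto simp: bilinear_def)
  have "\<exists>E. finite E \<and> span E = span S \<and> (\<forall>u\<in>E. \<forall>v\<in>E. h u v = (if u = v then 1 else 0))"
    if "finite S" for S
    using that
  proof induction
    case empty
    show ?case by (intro exI[of _ "{}"]) auto
  next
    case (insert a S)
    then obtain E where E: "finite E" "span E = span S"
      "\<And>u v. u \<in> E \<Longrightarrow> v \<in> E \<Longrightarrow> h u v = (if u = v then 1 else 0)" by blast
    define p where "p = (\<Sum>e\<in>E. h a e *\<^sub>R e)"
    define w where "w = a - p"
    have p: "p \<in> span E" unfolding p_def by (intro span_sum span_scale span_base)
    have we: "h w e = 0" if "e \<in> E" for e
    proof -
      have "h w e = h a e - (\<Sum>e'\<in>E. h a e' * h e' e)"
        unfolding w_def p_def
        by (simp add: linear_diff[OF linl] linear_sum[OF linl] linear_cmul[OF linl])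
      also have "(\<Sum>e'\<in>E. h a e' * h e' e) = (\<Sum>e'\<in>E. if e' = e then h a e else 0)"
        using E(3) that by (intro sum.cong) auto
      finally show ?thesis using E(1) that by simp
    qed
    have span1: "span (insert a S) = span (insert w E)"
    proof -
      have "span (insert a S) = span (insert a E)"
        using E(2) by (simp add: span_insert)
      also have "\<dots> = span (insert w E)"
      proof (rule span_eq[THEN iffD2], intro conjI subsetI)
        fix y assume "y \<in> insert a E"
        moreover have "a = w + p" by (simp add: w_def)
        moreover have "p \<in> span (insert w E)" using p span_mono[of E "insert w E"] by blast
        ultimately show "y \<in> span (insert w E)" by (auto intro: span_add span_base)
      next
        fix y assume "y \<in> insert w E"
        moreover have "p \<in> span (insert a E)" using p span_mono[of E "insert a E"] by blast
        ultimately show "y \<in> span (insert a E)" unfolding w_def by (auto intro: span_diff span_base)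
      qed
      finally show ?thesis .
    qed
    show ?case
    proof (cases "w = 0")
      case True
      then show ?thesis using E span1 by (intro exI[of _ E]) auto
    next
      case False
      define r where "r = sqrt (h w w)"
      define n where "n = (1 / r) *\<^sub>R w"
      have r: "r > 0" "r * r = h w w" using pos[OF False] by (auto simp: r_def)
      have nn: "h n n = 1"
        using r pos[OF False] unfolding n_def
        by (simp add: linear_cmul[OF linl] linear_cmul[OF linr] flip: r(2))
      have ne: "h n e = 0" "h e n = 0" if "e \<in> E" for e
        using we[OF that] sym unfolding n_def
        by (simp_all add: linear_cmul[OF linl] linear_cmul[OF linr])
      have "span (insert n E) = span (insert w E)"
      proof (rule span_eq[THEN iffD2], intro conjI subsetI)
        fix y assume "y \<in> insert n E"
        then show "y \<in> span (insert w E)" unfolding n_def by (auto intro: span_scale span_base)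
      next
        fix y assume "y \<in> insert w E"
        moreover have "w = r *\<^sub>R n" using r by (simp add: n_def)
        ultimately show "y \<in> span (insert n E)" by (auto intro: span_scale span_base)
      qed
      moreover have "\<forall>u\<in>insert n E. \<forall>v\<in>insert n E. h u v = (if u = v then 1 else 0)"
      proof -
        have "n \<notin> E" using ne(1) nn by force
        then show ?thesis using E(3) nn ne by auto
      qed
      ultimately show ?thesis
        using E(1) span1 by (intro exI[of _ "insert n E"]) simp
    qed
  qed
  from this[OF finite_Basis] show ?thesis
    by (auto simp: orthonormal_basis_def)
qed

text \<open>
  The Christoffel map of the Levi-Civita connection \<open>\<nabla>\<close>: for vector fields with components \<open>X\<close>, \<open>Y\<close> in the
  chart \<open>c\<close>, the covariant derivative has components \<open>ddir Y x (X x) + christoffel g c x (X x) (Y x)\<close>.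
  It is given by Koszul's formula for fields with constant components.
\<close>

definition christoffel :: "('p, 'e::euclidean_space) two_tensor \<Rightarrow> ('p, 'e) chart \<Rightarrow> 'e \<Rightarrow> 'e \<Rightarrow> 'e \<Rightarrow> 'e" where
  "christoffel g c x u v = (THE \<Gamma>. \<forall>w. g c x \<Gamma> w =
     (ddir (\<lambda>y. g c y v w) x u + ddir (\<lambda>y. g c y u w) x v - ddir (\<lambda>y. g c y u v) x w) / 2)"

definition normal_part :: "('e::euclidean_space \<Rightarrow> 'e \<Rightarrow> real) \<Rightarrow> 'e set \<Rightarrow> 'e \<Rightarrow> 'e" where
  "normal_part h T w = (THE n. w - n \<in> T \<and> (\<forall>t\<in>T. h n t = 0))"

text \<open>
  The second fundamental form \<open>II(U,V)\<close>, the normal part of \<open>\<nabla>\<^sub>U V\<close>, at the point with coordinates \<open>y\<close>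
  in the chart \<open>b\<close> of the submanifold. The arguments \<open>u\<close>, \<open>v\<close> are components of tangent vectors of the
  submanifold in \<open>b\<close>, extended to vector fields \<open>U\<close>, \<open>V\<close> on the submanifold with constant components
  (II is tensorial); the value is given by its components in the chart \<open>c\<close> of the ambient manifold.
  Along the submanifold, \<open>V\<close> has the ambient components \<open>ddir (transition b c) z v\<close>.
\<close>

definition second_fundamental_form ::
  "('p, 'e::euclidean_space) two_tensor \<Rightarrow> ('p, 'f::euclidean_space) chart \<Rightarrow> ('p, 'e) chart
     \<Rightarrow> 'f \<Rightarrow> 'f \<Rightarrow> 'f \<Rightarrow> 'e" where
  "second_fundamental_form g b c y u v =
     (let \<sigma> = transition b c in
      normal_part (g c (\<sigma> y)) (range (ddir \<sigma> y))
        (ddir (\<lambda>z. ddir \<sigma> z v) y u + christoffel g c (\<sigma> y) (ddir \<sigma> y u) (ddir \<sigma> y v)))"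

definition induced_metric ::
  "('p, 'e::euclidean_space) two_tensor \<Rightarrow> ('p, 'f::euclidean_space) chart \<Rightarrow> ('p, 'e) chart
     \<Rightarrow> 'f \<Rightarrow> 'f \<Rightarrow> 'f \<Rightarrow> real" where
  "induced_metric g b c y u v =
     g c (transition b c y) (ddir (transition b c) y u) (ddir (transition b c) y v)"

text \<open>
  The mean curvature vector is the normalised trace of the second fundamental form; it does not depend on the
  chosen orthonormal basis, which exists by \<open>orthonormal_basis_exists\<close>.
\<close>

definition mean_curvature ::
  "('p, 'e::euclidean_space) two_tensor \<Rightarrow> ('p, 'f::euclidean_space) chart \<Rightarrow> ('p, 'e) chart \<Rightarrow> 'f \<Rightarrow> 'e" where
  "mean_curvature g b c y =
     (1 / real DIM('f)) *\<^sub>R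
       (\<Sum>e\<in>(SOME E. orthonormal_basis (induced_metric g b c y) E). second_fundamental_form g b c y e e)"

definition minimal_submanifold ::
  "('p, 'e::euclidean_space) chart set \<Rightarrow> ('p, 'e) two_tensor
     \<Rightarrow> ('p, 'f::euclidean_space) chart set \<Rightarrow> bool" where
  "minimal_submanifold A g B \<longleftrightarrow>
     immersed_submanifold A B \<and> (\<forall>b\<in>B. \<forall>c\<in>A. \<forall>y\<in>overlap b c. mean_curvature g b c y = 0)"

definition minimal_foliation ::
  "('p, 'e::euclidean_space) chart set \<Rightarrow> ('p, 'e) two_tensor
     \<Rightarrow> ('p, 'f::euclidean_space) chart set set \<Rightarrow> bool" where
  "minimal_foliation A g \<F> \<longleftrightarrow> (\<forall>B\<in>\<F>. minimal_submanifold A g B)"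

end

theory Submission
  imports Defs
begin

text \<open>
  The proof is the classical one for complex submanifolds of almost Kaehler manifolds. Let \<open>\<alpha>\<close>, \<open>\<beta>\<close> be the
  two forms, with Reeb fields \<open>\<xi>\<close>, \<open>\<zeta>\<close>. A leaf of the characteristic foliation of \<open>\<alpha>\<close> is tangent to \<open>\<zeta>\<close>,
  normal to \<open>\<xi>\<close> and, by decomposability, \<open>\<phi>\<close>-invariant. The fundamental form \<open>g(X, \<phi> Y) = (d\<alpha> + d\<beta>)(X, Y)\<close>
  is closed; evaluating its differential on \<open>X\<close>, \<open>\<phi> X\<close> and a normal vector, with \<open>X\<close> tangent and orthogonal
  to \<open>\<zeta>\<close>, gives \<open>II(X, X) + II(\<phi> X, \<phi> X) = 0\<close>, while \<open>II(\<zeta>, \<zeta>) = 0\<close> since \<open>\<zeta>\<close> is geodesic. Hence the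
  trace of \<open>II\<close> vanishes.
\<close>

section \<open>Symmetry of second derivatives\<close>

lemma smooth_on_ddir:
  assumes "smooth_on S f"
  shows "smooth_on S (\<lambda>x. ddir f x v)"
  using assms unfolding smooth_on_def by (metis times_differentiable_on.simps(2))

lemma smooth_on_continuous_on:
  assumes "smooth_on S f"
  shows "continuous_on S f"
  using assms unfolding smooth_on_def by (metis times_differentiable_on.simps(1))

lemma has_derivative_ddir:
  assumes "f differentiable at x"
  shows "(f has_derivative ddir f x) (at x)"
  using assms frechet_derivative_works by blast

lemma ddir_eq:
  assumes "(f has_derivative f') (at x)"
  shows "ddir f x v = f' v"
  using frechet_derivative_at[OF assms] by simp

text \<open>Pairing with a fixed \<open>w\<close> makes the restriction to a line real-valued, so
  that the mean value theorem \<open>MVT2\<close> applies to it.\<close>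

lemma has_real_derivative_inner_along_line:
  fixes f :: "'a::real_normed_vector \<Rightarrow> 'b::real_inner"
  assumes "f differentiable at (p + t *\<^sub>R v)"
  shows "((\<lambda>t. f (p + t *\<^sub>R v) \<bullet> w) has_real_derivative ddir f (p + t *\<^sub>R v) v \<bullet> w) (at t)"
proof -
  have "((\<lambda>t. f (p + t *\<^sub>R v)) has_derivative (\<lambda>r. ddir f (p + t *\<^sub>R v) (r *\<^sub>R v))) (at t)"
    by (rule has_derivative_compose[of "\<lambda>t. p + t *\<^sub>R v" "\<lambda>r. r *\<^sub>R v", OF _ has_derivative_ddir[OF assms]])
       (auto intro!: derivative_eq_intros)
  then have "((\<lambda>t. f (p + t *\<^sub>R v) \<bullet> w) has_derivative (\<lambda>r. ddir f (p + t *\<^sub>R v) (r *\<^sub>R v) \<bullet> w)) (at t)"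
    by (rule has_derivative_inner_left)
  moreover have "(\<lambda>r. ddir f (p + t *\<^sub>R v) (r *\<^sub>R v) \<bullet> w) = (*) (ddir f (p + t *\<^sub>R v) v \<bullet> w)"
    using linear_cmul[OF linear_frechet_derivative[OF assms]] by (auto simp: mult.commute)
  ultimately show ?thesis
    by (simp only: has_field_derivative_def)
qed

text \<open>The mean value theorem is used twice: along \<open>v\<close> for the difference of
  \<open>f\<close> over the step \<open>s *\<^sub>R u\<close>, then along \<open>u\<close> for the
  resulting derivative in direction \<open>v\<close>. The second difference is symmetric in
  \<open>u\<close> and \<open>v\<close>, which makes the two orders of differentiation
  comparable.\<close>

lemma second_difference:
  fixes f :: "'a::real_normed_vector \<Rightarrow> 'b::real_inner"
  assumes f: "\<And>y. y \<in> ball x r \<Longrightarrow> f differentiable at y"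
    and f2: "\<And>y. y \<in> ball x r \<Longrightarrow> (\<lambda>y. ddir f y v) differentiable at y"
    and s: "s > 0" "s * (norm u + norm v) < r"
  shows "\<exists>y. dist x y \<le> s * (norm u + norm v) \<and>
    (f (x + s *\<^sub>R u + s *\<^sub>R v) - f (x + s *\<^sub>R u) - f (x + s *\<^sub>R v) + f x) \<bullet> w
      = s * s * (ddir (\<lambda>y. ddir f y v) y u \<bullet> w)"
proof -
  have close: "dist x (x + a *\<^sub>R u + b *\<^sub>R v) \<le> s * (norm u + norm v)"
    if "0 \<le> a" "a \<le> s" "0 \<le> b" "b \<le> s" for a b
  proof -
    have "dist (x + a *\<^sub>R u + b *\<^sub>R v) x \<le> norm (a *\<^sub>R u) + norm (b *\<^sub>R v)"
      using norm_triangle_ineq[of "a *\<^sub>R u" "b *\<^sub>R v"] by (simp add: dist_norm add.assoc)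
    also have "\<dots> \<le> s * norm u + s * norm v"
      using that by (intro add_mono) (auto intro!: mult_right_mono)
    finally show ?thesis by (simp add: dist_commute algebra_simps)
  qed
  have inball: "x + a *\<^sub>R u + b *\<^sub>R v \<in> ball x r"
    if "0 \<le> a" "a \<le> s" "0 \<le> b" "b \<le> s" for a b
    using close[OF that] s by simp
  \<comment> \<open>The summand \<open>0 *\<^sub>R u\<close> gives both terms the shape to which
    \<open>inball\<close> applies.\<close>
  define \<psi> where "\<psi> t = f (x + s *\<^sub>R u + t *\<^sub>R v) \<bullet> w - f (x + 0 *\<^sub>R u + t *\<^sub>R v) \<bullet> w" for t
  have "(\<psi> has_real_derivative
      ddir f (x + s *\<^sub>R u + t *\<^sub>R v) v \<bullet> w - ddir f (x + 0 *\<^sub>R u + t *\<^sub>R v) v \<bullet> w) (at t)"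
    if "0 \<le> t" "t \<le> s" for t
    unfolding \<psi>_def
    by (intro DERIV_diff has_real_derivative_inner_along_line f inball) (use that s in auto)
  from MVT2[OF s(1), of \<psi>, OF this] obtain t where t: "0 < t" "t < s"
    and \<psi>: "\<psi> s - \<psi> 0 =
      s * (ddir f (x + s *\<^sub>R u + t *\<^sub>R v) v \<bullet> w - ddir f (x + 0 *\<^sub>R u + t *\<^sub>R v) v \<bullet> w)"
    by auto
  have "((\<lambda>a. ddir f (x + t *\<^sub>R v + a *\<^sub>R u) v \<bullet> w) has_real_derivative
      ddir (\<lambda>y. ddir f y v) (x + t *\<^sub>R v + a *\<^sub>R u) u \<bullet> w) (at a)" if "0 \<le> a" "a \<le> s" for a
    by (rule has_real_derivative_inner_along_line[of "\<lambda>y. ddir f y v"], rule f2)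
       (use inball[OF that, of t] t in \<open>simp add: algebra_simps\<close>)
  from MVT2[OF s(1), of "\<lambda>a. ddir f (x + t *\<^sub>R v + a *\<^sub>R u) v \<bullet> w", OF this] obtain a
    where a: "0 < a" "a < s"
    and a_eq: "ddir f (x + t *\<^sub>R v + s *\<^sub>R u) v \<bullet> w - ddir f (x + t *\<^sub>R v + 0 *\<^sub>R u) v \<bullet> w
      = s * (ddir (\<lambda>y. ddir f y v) (x + t *\<^sub>R v + a *\<^sub>R u) u \<bullet> w)"
    by auto
  have "\<psi> s - \<psi> 0 = s * (s * (ddir (\<lambda>y. ddir f y v) (x + a *\<^sub>R u + t *\<^sub>R v) u \<bullet> w))"
    using \<psi> a_eq by (simp add: add_ac)
  moreover have "dist x (x + a *\<^sub>R u + t *\<^sub>R v) \<le> s * (norm u + norm v)"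
    using a t by (intro close) auto
  ultimately show ?thesis
    by (intro exI[of _ "x + a *\<^sub>R u + t *\<^sub>R v"]) (simp add: \<psi>_def algebra_simps)
qed

text \<open>Schwarz's theorem. Were the two mixed derivatives different at \<open>x\<close>,
  continuity would separate \<open>P\<close> and \<open>Q\<close> near \<open>x\<close>, while
  \<open>second_difference\<close>, used in both orders, yields nearby points \<open>y\<close>,
  \<open>z\<close> with \<open>P y = Q z\<close>.\<close>

lemma second_derivative_symmetric:
  fixes f :: "'a::real_normed_vector \<Rightarrow> 'b::real_inner"
  assumes S: "open S" "x \<in> S" and f: "smooth_on S f"
  shows "ddir (\<lambda>y. ddir f y v) x u = ddir (\<lambda>y. ddir f y u) x v"
proof (rule ccontr)
  \<comment> \<open>With the defect itself as test vector, \<open>P x - Q x\<close> is the squared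
    length of \<open>w\<close>.\<close>
  define w where "w = ddir (\<lambda>y. ddir f y v) x u - ddir (\<lambda>y. ddir f y u) x v"
  define P where "P y = ddir (\<lambda>y. ddir f y v) y u \<bullet> w" for y
  define Q where "Q y = ddir (\<lambda>y. ddir f y u) y v \<bullet> w" for y
  assume "\<not> ?thesis"
  then have "w \<bullet> w > 0" by (simp add: w_def)
  then have \<epsilon>: "\<bar>P x - Q x\<bar> / 2 > 0" by (simp add: P_def Q_def flip: inner_diff_left w_def)
  have "isCont (\<lambda>y. ddir (\<lambda>y. ddir f y a) y b) x" for a b
    using smooth_on_ddir[OF smooth_on_ddir[OF f], THEN smooth_on_continuous_on] S
    by (auto simp: continuous_on_eq_continuous_at)
  then have "isCont P x" "isCont Q x"
    unfolding P_def Q_def by (auto intro!: continuous_intros)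
  then obtain d1 d2 where d: "d1 > 0" "\<And>y. dist y x < d1 \<Longrightarrow> dist (P y) (P x) < \<bar>P x - Q x\<bar> / 2"
    "d2 > 0" "\<And>y. dist y x < d2 \<Longrightarrow> dist (Q y) (Q x) < \<bar>P x - Q x\<bar> / 2"
    using \<epsilon> unfolding continuous_at_eps_delta by metis
  obtain r0 where r0: "r0 > 0" "ball x r0 \<subseteq> S" using S openE by blast
  define r where "r = min r0 (min d1 d2)"
  have r: "r > 0" "ball x r \<subseteq> S" "r \<le> d1" "r \<le> d2" using r0 d by (auto simp: r_def)
  \<comment> \<open>The summand 1 keeps the denominator positive when \<open>u\<close> and
    \<open>v\<close> both vanish, and \<open>s * (norm u + norm v)\<close> stays strictly below
    \<open>r\<close>.\<close>
  define s where "s = r / (2 * (norm u + norm v + 1))"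
  have N: "norm u + norm v + 1 > 0" by (smt (verit) norm_ge_zero)
  then have s: "s > 0" using r by (simp add: s_def)
  have "s * (norm u + norm v) < s * (2 * (norm u + norm v + 1))"
    using s N by (intro mult_strict_left_mono) (smt (verit) norm_ge_zero)
  also have "\<dots> = r" using N by (simp add: s_def)
  finally have sr: "s * (norm u + norm v) < r" "s * (norm v + norm u) < r" by (simp_all add: add.commute)
  have diff: "f differentiable at y" "(\<lambda>y. ddir f y w) differentiable at y" if "y \<in> ball x r" for y w
    using that r(2) smooth_on_imp_differentiable f smooth_on_ddir by blast+
  obtain y where y: "dist x y \<le> s * (norm u + norm v)"
    "(f (x + s *\<^sub>R u + s *\<^sub>R v) - f (x + s *\<^sub>R u) - f (x + s *\<^sub>R v) + f x) \<bullet> w = s * s * P y"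
    using second_difference[OF diff s sr(1)] unfolding P_def by blast
  obtain z where z: "dist x z \<le> s * (norm v + norm u)"
    "(f (x + s *\<^sub>R v + s *\<^sub>R u) - f (x + s *\<^sub>R v) - f (x + s *\<^sub>R u) + f x) \<bullet> w = s * s * Q z"
    using second_difference[OF diff s sr(2)] unfolding Q_def by blast
  have "s * s * P y = s * s * Q z" unfolding y(2)[symmetric] z(2)[symmetric] by (simp add: algebra_simps)
  then have "P y = Q z" using s by simp
  moreover have "dist (P y) (P x) < \<bar>P x - Q x\<bar> / 2" "dist (Q z) (Q x) < \<bar>P x - Q x\<bar> / 2"
    using d(2)[of y] d(4)[of z] y(1) z(1) r sr by (auto simp: dist_commute)
  ultimately show False unfolding dist_real_def by (smt (verit) field_sum_of_halves)
qed


section \<open>Inner products and traces\<close>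

lemma inner_product_linear:
  assumes "inner_product h"
  shows "linear (h u)" "linear (\<lambda>u. h u v)"
  using assms by (auto simp: inner_product_def bilinear_def)

lemma inner_product_commute:
  assumes "inner_product h"
  shows "h u v = h v u"
  using assms by (auto simp: inner_product_def)

lemma inner_product_zero_iff:
  assumes "inner_product h"
  shows "h v v = 0 \<longleftrightarrow> v = 0"
  using assms linear_0[OF inner_product_linear(1)[OF assms], of v] by (auto simp: inner_product_def)

lemma orthonormal_basis_expansion:
  assumes h: "inner_product h" and E: "orthonormal_basis h E"
  shows "u = (\<Sum>e\<in>E. h u e *\<^sub>R e)"
proof -
  note lin = inner_product_linear[OF h]
  have E': "finite E" "span E = UNIV" "\<And>e e'. e \<in> E \<Longrightarrow> e' \<in> E \<Longrightarrow> h e e' = (if e = e' then 1 else 0)"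
    using E by (auto simp: orthonormal_basis_def)
  have "u \<in> span E" using E'(2) by simp
  then obtain r where r: "u = (\<Sum>e\<in>E. r e *\<^sub>R e)"
    unfolding span_finite[OF E'(1)] by blast
  have "h u e = r e" if "e \<in> E" for e
  proof -
    have "h u e = (\<Sum>e'\<in>E. r e' * h e' e)"
      unfolding r by (simp add: linear_sum[OF lin(2)] linear_cmul[OF lin(2)])
    also have "\<dots> = (\<Sum>e'\<in>E. if e' = e then r e else 0)"
      using E'(3) that by (intro sum.cong) auto
    finally show ?thesis using E'(1) that by simp
  qed
  then show ?thesis using r by simp
qed

lemma orthonormal_basis_linear_sum:
  assumes h: "inner_product h" and E: "orthonormal_basis h E" and l: "linear l"
  shows "(\<Sum>e\<in>E. h u e *\<^sub>R l e) = l u"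
proof -
  have "l u = l (\<Sum>e\<in>E. h u e *\<^sub>R e)" using orthonormal_basis_expansion[OF h E] by simp
  then show ?thesis by (simp add: linear_sum[OF l] linear_cmul[OF l])
qed

text \<open>In an orthonormal basis the representing vector has the coordinates \<open>l e\<close>.
  This justifies the definite description in \<open>christoffel\<close> and provides the tangential
  part in \<open>normal_part_spec\<close>.\<close>

lemma riesz_representation:
  assumes h: "inner_product h" and l: "linear l"
  shows "\<exists>!\<Gamma>. \<forall>w. h \<Gamma> w = l w"
proof (rule ex_ex1I)
  obtain E where E: "orthonormal_basis h E" using orthonormal_basis_exists[OF h] by blast
  note lin = inner_product_linear[OF h]
  show "\<exists>\<Gamma>. \<forall>w. h \<Gamma> w = l w"
  proof (intro exI allI)
    fix w
    have "h (\<Sum>e\<in>E. l e *\<^sub>R e) w = (\<Sum>e\<in>E. h w e *\<^sub>R l e)"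
      by (simp add: linear_sum[OF lin(1)] linear_cmul[OF lin(1)] inner_product_commute[OF h, of _ w] mult.commute)
    then show "h (\<Sum>e\<in>E. l e *\<^sub>R e) w = l w"
      using orthonormal_basis_linear_sum[OF h E l] by simp
  qed
next
  fix \<Gamma> \<Gamma>' assume "\<forall>w. h \<Gamma> w = l w" "\<forall>w. h \<Gamma>' w = l w"
  then have "h (\<Gamma> - \<Gamma>') (\<Gamma> - \<Gamma>') = 0"
    by (simp add: linear_diff[OF inner_product_linear(2)[OF h]])
  then show "\<Gamma> = \<Gamma>'" by (simp add: inner_product_zero_iff[OF h])
qed

text \<open>The orthogonal projection is computed on the parameter space: the tangential part of
  \<open>w\<close> is \<open>L u\<close>, where \<open>u\<close> represents the functional
  \<open>\<lambda>v. G w (L v)\<close> in the inner product pulled back along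
  \<open>L\<close>.\<close>

lemma normal_part_spec:
  fixes L :: "'f::euclidean_space \<Rightarrow> 'e::euclidean_space"
  assumes G: "inner_product G" and L: "linear L" and h: "inner_product (\<lambda>u v. G (L u) (L v))"
  shows "w - normal_part G (range L) w \<in> range L \<and> (\<forall>t\<in>range L. G (normal_part G (range L) w) t = 0)"
  unfolding normal_part_def
proof (rule theI', rule ex_ex1I)
  note lin = inner_product_linear[OF G]
  have "linear (\<lambda>v. G w (L v))" using linear_compose[OF L lin(1)] by (simp add: comp_def)
  then obtain u where u: "G (L u) (L v) = G w (L v)" for v
    using riesz_representation[OF h] by blast
  show "\<exists>n. w - n \<in> range L \<and> (\<forall>t\<in>range L. G n t = 0)"
    by (intro exI[of _ "w - L u"]) (auto simp: linear_diff[OF lin(2)] u)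
next
  note lin = inner_product_linear[OF G]
  fix n n' assume n: "w - n \<in> range L \<and> (\<forall>t\<in>range L. G n t = 0)" "w - n' \<in> range L \<and> (\<forall>t\<in>range L. G n' t = 0)"
  have "(w - n') - (w - n) \<in> range L"
    using n subspace_diff[OF linear_subspace_image[OF L subspace_UNIV]] by blast
  then have "n - n' \<in> range L" by simp
  then have "G n (n - n') = 0" "G n' (n - n') = 0" using n by blast+
  then have "G (n - n') (n - n') = 0"
    by (simp add: linear_diff[OF lin(2)] del: right_minus_eq)
  then show "n = n'" by (simp add: inner_product_zero_iff[OF G])
qed

text \<open>
  As \<open>J\<close> is orthogonal on the complement of \<open>z\<close>, both \<open>b e e\<close> and \<open>b (J e) (J e)\<close> sum to the trace over \<open>E\<close>,
  while their total vanishes.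
\<close>

lemma trace_eq_0_if_invariant:
  fixes h :: "'f::euclidean_space \<Rightarrow> 'f \<Rightarrow> real"
  assumes h: "inner_product h" and E: "orthonormal_basis h E" and b: "bilinear b"
    and skew: "\<And>u v. h (J u) v = - h u (J v)" and Jz: "J z = 0"
    and JJ: "\<And>u. J (J u) = - u + h u z *\<^sub>R z" and zz: "h z z = 1"
    and bz: "b z z = 0" and anti: "\<And>u. h u z = 0 \<Longrightarrow> b u u + b (J u) (J u) = 0"
  shows "(\<Sum>e\<in>E. b e e) = (0::real)"
proof -
  note lin = inner_product_linear[OF h] and sym = inner_product_commute[OF h]
  have bl: "linear (b u)" "linear (\<lambda>u. b u v)" for u v using b by (auto simp: bilinear_def)
  have sum_h: "(\<Sum>e\<in>E. h u e * l e) = l u" if "linear l" for u and l :: "'f \<Rightarrow> real"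
    using orthonormal_basis_linear_sum[OF h E that] by simp
  \<comment> \<open>Linearity of \<open>J\<close> is not among the hypotheses; skewness and
    definiteness of \<open>h\<close> give the invariance under shifts along
    \<open>z\<close>.\<close>
  have Jlin: "J (u + r *\<^sub>R z) = J u" for u r
  proof -
    have "h z (J v) = 0" for v
      using skew[of z v] by (simp add: Jz linear_0[OF lin(2)])
    then have "h (J (u + r *\<^sub>R z) - J u) v = 0" for v
      by (simp add: linear_diff[OF lin(2)] skew linear_add[OF lin(2)] linear_cmul[OF lin(2)])
    then show ?thesis using inner_product_zero_iff[OF h] by (metis eq_iff_diff_eq_0)
  qed
  \<comment> \<open>\<open>anti\<close> is applied to the part of \<open>e\<close> orthogonal to
    \<open>z\<close>, which \<open>J\<close> maps to \<open>J e\<close>; since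
    \<open>b z z = 0\<close>, only the mixed terms remain.\<close>
  have "b e e + b (J e) (J e) = h z e * b e z + h z e * b z e" for e
  proof -
    have "b (e - h e z *\<^sub>R z) (e - h e z *\<^sub>R z) + b (J e) (J e) = 0"
      using anti[of "e + (- h e z) *\<^sub>R z"] Jlin[of e "- h e z"]
      by (simp add: linear_diff[OF lin(2)] linear_cmul[OF lin(2)] zz)
    then show ?thesis
      unfolding linear_diff[OF bl(1)] linear_diff[OF bl(2)] linear_cmul[OF bl(1)] linear_cmul[OF bl(2)] bz
      unfolding sym[of e z] by simp
  qed
  then have "(\<Sum>e\<in>E. b e e) + (\<Sum>e\<in>E. b (J e) (J e)) = (\<Sum>e\<in>E. h z e * b e z) + (\<Sum>e\<in>E. h z e * b z e)"
    unfolding sum.distrib[symmetric] by simp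
  also have "\<dots> = 0" unfolding sum_h[OF bl(1)] sum_h[OF bl(2)] bz by simp
  finally have 1: "(\<Sum>e\<in>E. b e e) + (\<Sum>e\<in>E. b (J e) (J e)) = 0" .
  have hJ: "h (J f) (J f') = h f f' - h z f * h z f'" for f f'
    unfolding skew JJ linear_add[OF lin(1)] linear_neg[OF lin(1)] linear_cmul[OF lin(1)]
    unfolding sym[of f z] sym[of f' z] by simp
  have skew': "h (J e) f = - h (J f) e" and skew'': "h (J e) f = - h e (J f)" for e f
    using skew[of e f] sym[of e "J f"] by simp_all
  \<comment> \<open>Both copies of \<open>J e\<close> are expanded in \<open>E\<close>; skewness
    moves \<open>J\<close> onto \<open>f\<close> and \<open>f'\<close>, and the sum over
    \<open>e\<close> collapses to \<open>h (J f) (J f')\<close>.\<close>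
  have "(\<Sum>e\<in>E. b (J e) (J e)) = (\<Sum>e\<in>E. \<Sum>f\<in>E. \<Sum>f'\<in>E. h (J e) f * (h (J e) f' * b f f'))"
    unfolding sum_distrib_left[symmetric] sum_h[OF bl(1)] sum_h[OF bl(2)] ..
  also have "\<dots> = (\<Sum>f\<in>E. \<Sum>f'\<in>E. \<Sum>e\<in>E. h (J e) f * (h (J e) f' * b f f'))"
    by (rule trans[OF sum.swap], rule sum.cong[OF refl], rule sum.swap)
  also have "\<dots> = (\<Sum>f\<in>E. \<Sum>f'\<in>E. h (J f) (J f') * b f f')"
  proof (intro sum.cong refl)
    fix f f' 
    have "(\<Sum>e\<in>E. h (J e) f * (h (J e) f' * b f f')) = (\<Sum>e\<in>E. h (J f) e * h e (J f')) * b f f'"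
      by (simp add: sum_distrib_right skew'[of _ f] skew''[of _ f'] mult.assoc)
    also have "(\<Sum>e\<in>E. h (J f) e * h e (J f')) = h (J f) (J f')"
      by (rule sum_h[OF lin(2)])
    finally show "(\<Sum>e\<in>E. h (J e) f * (h (J e) f' * b f f')) = h (J f) (J f') * b f f'" .
  qed
  also have "\<dots> = (\<Sum>f\<in>E. (\<Sum>f'\<in>E. h f f' * b f f') - h z f * (\<Sum>f'\<in>E. h z f' * b f f'))"
    by (simp add: hJ left_diff_distrib sum_subtractf sum_distrib_left mult.assoc)
  also have "\<dots> = (\<Sum>f\<in>E. b f f) - (\<Sum>f\<in>E. h z f * b f z)"
    unfolding sum_h[OF bl(1)] sum_subtractf ..
  also have "\<dots> = (\<Sum>f\<in>E. b f f)"
    unfolding sum_h[OF bl(2)] bz by simp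
  finally show ?thesis using 1 by simp
qed


section \<open>Differentiating fields of linear maps\<close>

lemma apply_linear_expansion:
  fixes a :: "'v::euclidean_space \<Rightarrow> 'w::real_vector"
  assumes "linear a"
  shows "a w = (\<Sum>i\<in>Basis. (w \<bullet> i) *\<^sub>R a i)"
  using linear_sum[OF assms, of "\<lambda>i. (w \<bullet> i) *\<^sub>R i" Basis]
  by (simp add: euclidean_representation linear_cmul[OF assms])

context
  fixes S :: "'x::real_normed_vector set" and a :: "'x \<Rightarrow> 'v::euclidean_space \<Rightarrow> 'w::real_normed_vector"
    and p :: 'x
  assumes S: "open S" "p \<in> S" and lin: "\<And>x. x \<in> S \<Longrightarrow> linear (a x)"
    and diff: "\<And>v. (\<lambda>x. a x v) differentiable at p"
begin

lemma has_derivative_apply_linear_const: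
  "((\<lambda>x. a x w) has_derivative (\<lambda>u. \<Sum>i\<in>Basis. (w \<bullet> i) *\<^sub>R ddir (\<lambda>x. a x i) p u)) (at p)"
proof -
  have "((\<lambda>x. \<Sum>i\<in>Basis. (w \<bullet> i) *\<^sub>R a x i) has_derivative
      (\<lambda>u. \<Sum>i\<in>Basis. (w \<bullet> i) *\<^sub>R ddir (\<lambda>x. a x i) p u)) (at p)"
    by (intro has_derivative_sum has_derivative_scaleR_right has_derivative_ddir diff)
  then show ?thesis
    by (rule has_derivative_transform_within_open[OF _ S]) (simp add: apply_linear_expansion[OF lin, symmetric])
qed

lemma linear_ddir_apply: "linear (\<lambda>w. ddir (\<lambda>x. a x w) p u)"
proof -
  have eq: "(\<lambda>w. ddir (\<lambda>x. a x w) p u) = (\<lambda>w. \<Sum>i\<in>Basis. (w \<bullet> i) *\<^sub>R ddir (\<lambda>x. a x i) p u)"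
    by (rule ext, rule ddir_eq[OF has_derivative_apply_linear_const])
  show ?thesis
    by (subst eq, intro linearI) (simp_all add: inner_add_left scaleR_left_distrib sum.distrib scaleR_sum_right)
qed

text \<open>The product rule for a tensor field applied to a vector field along
  \<open>\<sigma>\<close>. Differentiability of \<open>a\<close> is given for fixed arguments only,
  hence the expansion in \<open>Basis\<close>, which reduces the claim to products of scalar and
  vector functions.\<close>

lemma has_derivative_apply_linear:
  assumes U: "open U" "y \<in> U" "\<And>z. z \<in> U \<Longrightarrow> \<sigma> z \<in> S" and p: "p = \<sigma> y"
    and \<sigma>: "(\<sigma> has_derivative \<sigma>') (at y)" and W: "(W has_derivative W') (at y)"
  shows "((\<lambda>z. a (\<sigma> z) (W z)) has_derivative
    (\<lambda>u. ddir (\<lambda>x. a x (W y)) p (\<sigma>' u) + a p (W' u))) (at y)"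
proof -
  have comp: "((\<lambda>z. a (\<sigma> z) i) has_derivative (\<lambda>u. ddir (\<lambda>x. a x i) p (\<sigma>' u))) (at y)" for i
    using has_derivative_compose[OF \<sigma>, of "\<lambda>x. a x i"] has_derivative_ddir[OF diff] p by blast
  have "((\<lambda>z. \<Sum>i\<in>Basis. (W z \<bullet> i) *\<^sub>R a (\<sigma> z) i) has_derivative
      (\<lambda>u. \<Sum>i\<in>Basis. (W y \<bullet> i) *\<^sub>R ddir (\<lambda>x. a x i) p (\<sigma>' u) + (W' u \<bullet> i) *\<^sub>R a (\<sigma> y) i)) (at y)"
    by (intro has_derivative_sum has_derivative_scaleR has_derivative_inner_left W comp)
  then have "((\<lambda>z. a (\<sigma> z) (W z)) has_derivative
      (\<lambda>u. \<Sum>i\<in>Basis. (W y \<bullet> i) *\<^sub>R ddir (\<lambda>x. a x i) p (\<sigma>' u) + (W' u \<bullet> i) *\<^sub>R a (\<sigma> y) i)) (at y)"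
    by (rule has_derivative_transform_within_open[OF _ U(1,2)])
       (simp add: apply_linear_expansion[OF lin[OF U(3)], symmetric])
  then show ?thesis
    unfolding sum.distrib p[symmetric] ddir_eq[OF has_derivative_apply_linear_const, symmetric]
      apply_linear_expansion[OF lin[OF S(2)], symmetric] .
qed

lemma ddir_apply_linear:
  assumes U: "open U" "y \<in> U" "\<And>z. z \<in> U \<Longrightarrow> \<sigma> z \<in> S" and p: "p = \<sigma> y"
    and \<sigma>: "\<sigma> differentiable at y" and W: "W differentiable at y"
  shows "(\<lambda>z. a (\<sigma> z) (W z)) differentiable at y"
    and "ddir (\<lambda>z. a (\<sigma> z) (W z)) y u = ddir (\<lambda>x. a x (W y)) p (ddir \<sigma> y u) + a p (ddir W y u)"
  using has_derivative_apply_linear[OF U p has_derivative_ddir[OF \<sigma>] has_derivative_ddir[OF W]]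
  by (auto simp: differentiable_def ddir_eq)

lemma ddir_apply_linear_field:
  assumes W: "W differentiable at p"
  shows "(\<lambda>x. a x (W x)) differentiable at p"
    and "ddir (\<lambda>x. a x (W x)) p u = ddir (\<lambda>x. a x (W p)) p u + a p (ddir W p u)"
  using ddir_apply_linear[of S p "\<lambda>x. x" W] S W by simp_all

end

lemma ddir_cong_open:
  assumes "open U" "y \<in> U" "f differentiable at y" "\<And>z. z \<in> U \<Longrightarrow> f z = f' z"
  shows "ddir f y u = ddir f' y u"
  using frechet_derivative_transform_within_open[OF assms(3,1,2)] assms(4) by metis

text \<open>Koszul's right-hand side is linear in \<open>w\<close>, so
  \<open>riesz_representation\<close> shows that the description defining \<open>christoffel\<close>
  denotes.\<close>

lemma christoffel_spec:
  fixes g :: "('p, 'e::euclidean_space) two_tensor"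
  assumes S: "open S" "x \<in> S" and ip: "\<And>y. y \<in> S \<Longrightarrow> inner_product (g c y)"
    and diff: "\<And>u v. (\<lambda>y. g c y u v) differentiable at x"
  shows "g c x (christoffel g c x u v) w =
    (ddir (\<lambda>y. g c y v w) x u + ddir (\<lambda>y. g c y u w) x v - ddir (\<lambda>y. g c y u v) x w) / 2"
proof -
  have 1: "linear (\<lambda>w. ddir (\<lambda>y. g c y v w) x u)" for u v
    by (rule linear_ddir_apply[OF S inner_product_linear(1)[OF ip] diff])
  have "linear (\<lambda>w. (ddir (\<lambda>y. g c y v w) x u + ddir (\<lambda>y. g c y u w) x v - ddir (\<lambda>y. g c y u v) x w) / 2)"
    by (intro linearI)
       (simp_all add: linear_add[OF 1] linear_cmul[OF 1] linear_add[OF linear_frechet_derivative[OF diff]]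
         linear_cmul[OF linear_frechet_derivative[OF diff]] field_simps)
  from theI'[OF riesz_representation[OF ip[OF S(2)] this]] show ?thesis
    unfolding christoffel_def by blast
qed


section \<open>Metric contact pairs in a chart\<close>

text \<open>The conditions on the pair in one chart, arranged around the foliation of
  \<open>\<alpha>\<close>: \<open>\<zeta>\<close> is tangent to it and \<open>\<xi>\<close> normal.
  Exchanging the roles of the two forms gives the other foliation.\<close>

locale metric_contact_pair_in_chart =
  fixes c :: "('p, 'e::euclidean_space) chart"
    and \<alpha> \<beta> :: "('p, 'e) one_form"
    and \<xi> \<zeta> :: "('p, 'e) vector_field"
    and \<phi> :: "('p, 'e) endomorphism_field"
    and g :: "('p, 'e) two_tensor"
  assumes open_chart: "open (chart_image c)"
    and fields_smooth: "smooth_on (chart_image c) (\<lambda>x. \<alpha> c x v)" "smooth_on (chart_image c) (\<lambda>x. \<beta> c x v)"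
      "smooth_on (chart_image c) (\<xi> c)" "smooth_on (chart_image c) (\<zeta> c)"
      "smooth_on (chart_image c) (\<lambda>x. \<phi> c x v)" "smooth_on (chart_image c) (\<lambda>x. g c x u v)"
    and fields_linear: "x \<in> chart_image c \<Longrightarrow> linear (\<alpha> c x)" "x \<in> chart_image c \<Longrightarrow> linear (\<beta> c x)"
      "x \<in> chart_image c \<Longrightarrow> linear (\<phi> c x)"
    and metric: "x \<in> chart_image c \<Longrightarrow> inner_product (g c x)"
    and reeb: "x \<in> chart_image c \<Longrightarrow> \<beta> c x (\<zeta> c x) = 1" "x \<in> chart_image c \<Longrightarrow> \<alpha> c x (\<zeta> c x) = 0"
      "x \<in> chart_image c \<Longrightarrow> ext_deriv \<alpha> c x (\<zeta> c x) v = 0"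
      "x \<in> chart_image c \<Longrightarrow> ext_deriv \<beta> c x (\<zeta> c x) v = 0"
    and \<phi>_\<phi>: "x \<in> chart_image c \<Longrightarrow> \<phi> c x (\<phi> c x v) = - v + \<alpha> c x v *\<^sub>R \<xi> c x + \<beta> c x v *\<^sub>R \<zeta> c x"
    and \<phi>_reeb: "x \<in> chart_image c \<Longrightarrow> \<phi> c x (\<zeta> c x) = 0"
    and g_\<phi>: "x \<in> chart_image c \<Longrightarrow> g c x u (\<phi> c x v) = ext_deriv \<alpha> c x u v + ext_deriv \<beta> c x u v"
    and g_reeb: "x \<in> chart_image c \<Longrightarrow> g c x u (\<xi> c x) = \<alpha> c x u"
      "x \<in> chart_image c \<Longrightarrow> g c x u (\<zeta> c x) = \<beta> c x u"
begin

lemma fields_differentiable: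
  assumes "p \<in> chart_image c"
  shows "(\<lambda>x. \<alpha> c x v) differentiable at p" "(\<lambda>x. \<beta> c x v) differentiable at p"
    "\<xi> c differentiable at p" "\<zeta> c differentiable at p"
    "(\<lambda>x. \<phi> c x v) differentiable at p" "(\<lambda>x. g c x u v) differentiable at p"
    "(\<lambda>x. ddir (\<lambda>x. \<alpha> c x v) x u) differentiable at p"
    "(\<lambda>x. ddir (\<lambda>x. \<beta> c x v) x u) differentiable at p"
  using fields_smooth smooth_on_ddir smooth_on_imp_differentiable assms by blast+

lemmas g_linear = inner_product_linear[OF metric]
lemmas g_commute = inner_product_commute[OF metric]

text \<open>By the compatibility of \<open>g\<close> and \<open>\<phi>\<close>, this is the
  antisymmetry of the exterior derivatives.\<close>

lemma \<phi>_skew: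
  assumes "x \<in> chart_image c"
  shows "g c x (\<phi> c x u) v = - g c x u (\<phi> c x v)"
  using g_\<phi>[OF assms, of u v] g_\<phi>[OF assms, of v u] g_commute[OF assms, of v "\<phi> c x u"]
  by (simp add: ext_deriv_def field_simps)

section \<open>Closedness of the fundamental form\<close>

lemma ddir_g_commute:
  assumes p: "p \<in> chart_image c"
  shows "ddir (\<lambda>x. g c x u v) p w = ddir (\<lambda>x. g c x v u) p w"
  by (rule ddir_cong_open[OF open_chart p fields_differentiable(6)[OF p]]) (rule g_commute)

lemma ddir_g_linear:
  assumes p: "p \<in> chart_image c"
  shows "linear (\<lambda>v. ddir (\<lambda>x. g c x u v) p w)" "linear (\<lambda>u. ddir (\<lambda>x. g c x u v) p w)"
    "linear (ddir (\<lambda>x. g c x u v) p)"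
proof -
  show 1: "linear (\<lambda>v. ddir (\<lambda>x. g c x u v) p w)" for u
    by (rule linear_ddir_apply[OF open_chart p g_linear(1) fields_differentiable(6)[OF p]])
  show "linear (\<lambda>u. ddir (\<lambda>x. g c x u v) p w)"
    unfolding ddir_g_commute[OF p, of _ v] by (rule 1)
  show "linear (ddir (\<lambda>x. g c x u v) p)"
    by (rule linear_frechet_derivative[OF fields_differentiable(6)[OF p]])
qed

text \<open>The derivative along \<open>w\<close> of the fundamental form on fields with constant
  components. Brackets of such fields vanish, so cyclic sums of this expression are, up to a
  constant factor, its exterior derivative.\<close>

definition fundamental_form_deriv :: "'e \<Rightarrow> 'e \<Rightarrow> 'e \<Rightarrow> 'e \<Rightarrow> real" where
  "fundamental_form_deriv p w u v = ddir (\<lambda>x. g c x u (\<phi> c x v)) p w"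

lemma fundamental_form_differentiable:
  assumes p: "p \<in> chart_image c"
  shows "(\<lambda>x. g c x u (\<phi> c x v)) differentiable at p"
  by (rule ddir_apply_linear_field(1)[OF open_chart p g_linear(1) fields_differentiable(6,5)[OF p]])

lemma fundamental_form_deriv_eq:
  assumes p: "p \<in> chart_image c"
  shows "fundamental_form_deriv p w u v =
    ddir (\<lambda>x. g c x u (\<phi> c p v)) p w + g c p u (ddir (\<lambda>x. \<phi> c x v) p w)"
  unfolding fundamental_form_deriv_def
  by (rule ddir_apply_linear_field(2)[OF open_chart p g_linear(1) fields_differentiable(6,5)[OF p]])

lemma fundamental_form_deriv_antisym:
  assumes p: "p \<in> chart_image c"
  shows "fundamental_form_deriv p w u v = - fundamental_form_deriv p w v u"
proof -
  have "fundamental_form_deriv p w u v = ddir (\<lambda>x. - g c x v (\<phi> c x u)) p w"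
    unfolding fundamental_form_deriv_def
    by (rule ddir_cong_open[OF open_chart p fundamental_form_differentiable[OF p]])
       (metis g_commute \<phi>_skew)
  also have "\<dots> = - fundamental_form_deriv p w v u"
    unfolding fundamental_form_deriv_def
    by (rule ddir_eq[OF has_derivative_minus[OF has_derivative_ddir[OF fundamental_form_differentiable[OF p]]]])
  finally show ?thesis .
qed

text \<open>The fundamental form is the exterior derivative of \<alpha> + \<beta>, so this is
  \<open>d d = 0\<close>: by the symmetry of \<open>D\<close> in its first two arguments, the terms
  of the cyclic sum cancel in pairs.\<close>

lemma fundamental_form_closed:
  assumes p: "p \<in> chart_image c"
  shows "fundamental_form_deriv p u v w + fundamental_form_deriv p v w u + fundamental_form_deriv p w u v = 0"
proof -
  define D where "D u v w = ddir (\<lambda>x. ddir (\<lambda>x. \<alpha> c x w) x v) p u + ddir (\<lambda>x. ddir (\<lambda>x. \<beta> c x w) x v) p u"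
    for u v w
  have "fundamental_form_deriv p u v w = (D u v w - D u w v) / 2" for u v w
  proof -
    have "fundamental_form_deriv p u v w =
      ddir (\<lambda>x. 1 / 2 * (ddir (\<lambda>x. \<alpha> c x w) x v - ddir (\<lambda>x. \<alpha> c x v) x w
        + (ddir (\<lambda>x. \<beta> c x w) x v - ddir (\<lambda>x. \<beta> c x v) x w))) p u"
      unfolding fundamental_form_deriv_def
      by (rule ddir_cong_open[OF open_chart p fundamental_form_differentiable[OF p]])
         (simp add: g_\<phi> ext_deriv_def field_simps)
    also have "\<dots> = (D u v w - D u w v) / 2"
      unfolding D_def
      by (rule trans[OF ddir_eq], (rule has_derivative_mult_right has_derivative_add has_derivative_diff
          has_derivative_ddir fields_differentiable p)+) (simp add: field_simps)
    finally show ?thesis .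
  qed
  note F = this
  have "D u v w = D v u w" for u v w
    unfolding D_def
    using second_derivative_symmetric[OF open_chart p fields_smooth(1)]
      second_derivative_symmetric[OF open_chart p fields_smooth(2)] by metis
  from this[of u v w] this[of v w u] this[of w u v] show ?thesis
    unfolding F by (simp add: field_simps)
qed

text \<open>Obtained by differentiating \<open>\<phi>_\<phi>\<close> at fixed \<open>v\<close>.
  Derivatives of \<open>\<xi>\<close> and \<open>\<zeta>\<close> drop out because their coefficients
  vanish at \<open>p\<close>.\<close>

lemma ddir_\<phi>_\<phi>:
  assumes p: "p \<in> chart_image c" and v: "\<alpha> c p v = 0" "\<beta> c p v = 0"
  shows "ddir (\<lambda>x. \<phi> c x (\<phi> c p v)) p w + \<phi> c p (ddir (\<lambda>x. \<phi> c x v) p w)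
    = ddir (\<lambda>x. \<alpha> c x v) p w *\<^sub>R \<xi> c p + ddir (\<lambda>x. \<beta> c x v) p w *\<^sub>R \<zeta> c p"
proof -
  note d = ddir_apply_linear_field[OF open_chart p fields_linear(3) fields_differentiable(5,5)[OF p], of v]
  have "ddir (\<lambda>x. \<phi> c x (\<phi> c p v)) p w + \<phi> c p (ddir (\<lambda>x. \<phi> c x v) p w) = ddir (\<lambda>x. \<phi> c x (\<phi> c x v)) p w"
    using d(2) by simp
  also have "\<dots> = ddir (\<lambda>x. - v + \<alpha> c x v *\<^sub>R \<xi> c x + \<beta> c x v *\<^sub>R \<zeta> c x) p w"
    by (rule ddir_cong_open[OF open_chart p d(1) \<phi>_\<phi>])
  also have "\<dots> = ddir (\<lambda>x. \<alpha> c x v) p w *\<^sub>R \<xi> c p + ddir (\<lambda>x. \<beta> c x v) p w *\<^sub>R \<zeta> c p"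
    by (rule trans[OF ddir_eq], (rule derivative_eq_intros has_derivative_ddir fields_differentiable p refl)+)
       (simp add: v)
  finally show ?thesis .
qed

text \<open>Closedness of the fundamental form, evaluated on \<open>v\<close>, \<open>\<phi> v\<close> and \<open>n\<close>.\<close>

lemma horizontal_identity:
  fixes p v n
  assumes p: "p \<in> chart_image c" and v: "\<alpha> c p v = 0" "\<beta> c p v = 0" and n: "\<beta> c p n = 0"
  defines "Jv \<equiv> \<phi> c p v"
  shows "g c p (ddir (\<lambda>x. \<phi> c x v) p Jv) n - g c p (ddir (\<lambda>x. \<phi> c x v) p v) (\<phi> c p n)
    - \<alpha> c p n * ddir (\<lambda>x. \<alpha> c x v) p v
    + ddir (\<lambda>x. g c x v n) p v + ddir (\<lambda>x. g c x Jv n) p Jv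
    - ddir (\<lambda>x. g c x v v) p n / 2 - ddir (\<lambda>x. g c x Jv Jv) p n / 2 = 0"
proof -
  note gl = g_linear[OF p] and gc = g_commute[OF p] and dl = ddir_g_linear[OF p]
  have JJ: "\<phi> c p Jv = - v" unfolding Jv_def using \<phi>_\<phi>[OF p] v by simp
  have JD: "ddir (\<lambda>x. \<phi> c x Jv) p w = ddir (\<lambda>x. \<alpha> c x v) p w *\<^sub>R \<xi> c p + ddir (\<lambda>x. \<beta> c x v) p w *\<^sub>R \<zeta> c p
     - \<phi> c p (ddir (\<lambda>x. \<phi> c x v) p w)" for w
    using ddir_\<phi>_\<phi>[OF p v] unfolding Jv_def by (simp add: algebra_simps)
  \<comment> \<open>Skewness moves the outer \<open>\<phi>\<close> onto \<open>u\<close>, so that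
    every remaining derivative of \<open>\<phi>\<close> is applied to \<open>v\<close>.\<close>
  have gJD: "g c p u (ddir (\<lambda>x. \<phi> c x Jv) p w) = ddir (\<lambda>x. \<alpha> c x v) p w * \<alpha> c p u + ddir (\<lambda>x. \<beta> c x v) p w * \<beta> c p u
     + g c p (\<phi> c p u) (ddir (\<lambda>x. \<phi> c x v) p w)" for u w
    unfolding JD linear_diff[OF gl(1)] linear_add[OF gl(1)] linear_cmul[OF gl(1)] g_reeb[OF p] \<phi>_skew[OF p]
    by simp
  have 1: "fundamental_form_deriv p w n Jv = - ddir (\<lambda>x. g c x n v) p w + ddir (\<lambda>x. \<alpha> c x v) p w * \<alpha> c p n
     + g c p (\<phi> c p n) (ddir (\<lambda>x. \<phi> c x v) p w)" for w
    unfolding fundamental_form_deriv_eq[OF p] JJ gJD n linear_neg[OF dl(1)] by simp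
  have 2: "fundamental_form_deriv p w v Jv = - ddir (\<lambda>x. g c x v v) p w
     + g c p Jv (ddir (\<lambda>x. \<phi> c x v) p w)" for w
    unfolding fundamental_form_deriv_eq[OF p] JJ gJD v linear_neg[OF dl(1)] by (simp add: Jv_def)
  have 3: "fundamental_form_deriv p w u v = ddir (\<lambda>x. g c x u Jv) p w + g c p u (ddir (\<lambda>x. \<phi> c x v) p w)" for w u
    unfolding fundamental_form_deriv_eq[OF p] Jv_def ..
  \<comment> \<open>\<open>2\<close> and \<open>3\<close>, joined by antisymmetry, evaluate the term
    differentiated along \<open>n\<close> in two ways; their average removes the derivative of
    \<open>\<phi>\<close> along \<open>n\<close> and produces the halves.\<close>
  show ?thesis
    using fundamental_form_closed[OF p, of v Jv n] 1[of v] 2[of n] 3[of Jv n] 3[of n Jv]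
      fundamental_form_deriv_antisym[OF p, of v Jv n] fundamental_form_deriv_antisym[OF p, of n v Jv]
      ddir_g_commute[OF p, of n v v] ddir_g_commute[OF p, of n Jv Jv]
      gc[of "ddir (\<lambda>x. \<phi> c x v) p Jv" n] gc[of "ddir (\<lambda>x. \<phi> c x v) p v" "\<phi> c p n"]
    unfolding mult.commute[of "\<alpha> c p n"] by linarith
qed

text \<open>By Koszul's formula the left side is g(\<nabla>_\<zeta> \<zeta>, n), so
  \<open>\<zeta>\<close> is geodesic. The inputs are the derivatives of g(u, \<zeta>) = \<beta>(u)
  and \<beta>(\<zeta>) = 1, and the vanishing of d\<beta>(\<zeta>, n), which exchanges
  \<open>z\<close> and \<open>n\<close> in \<open>4\<close>.\<close>

lemma reeb_identity:
  fixes p n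
  assumes p: "p \<in> chart_image c"
  defines "z \<equiv> \<zeta> c p"
  shows "g c p (ddir (\<zeta> c) p z) n + ddir (\<lambda>x. g c x z n) p z - ddir (\<lambda>x. g c x z z) p n / 2 = 0"
proof -
  have 1: "ddir (\<lambda>x. g c x u z) p w + g c p u (ddir (\<zeta> c) p w) = ddir (\<lambda>x. \<beta> c x u) p w" for u w
  proof -
    note d = ddir_apply_linear_field[OF open_chart p g_linear(1) fields_differentiable(6,4)[OF p], of u]
    show ?thesis
      using d(2) ddir_cong_open[OF open_chart p d(1) g_reeb(2)] by (simp add: z_def)
  qed
  have 2: "ddir (\<lambda>x. \<beta> c x z) p w + \<beta> c p (ddir (\<zeta> c) p w) = 0" for w
  proof -
    note d = ddir_apply_linear_field[OF open_chart p fields_linear(2) fields_differentiable(2,4)[OF p]]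
    show ?thesis
      using d(2) ddir_cong_open[OF open_chart p d(1) reeb(1)] by (simp add: z_def)
  qed
  have 3: "\<beta> c p u = g c p z u" for u
    using g_reeb(2)[OF p] g_commute[OF p] by (simp add: z_def)
  have 4: "ddir (\<lambda>x. \<beta> c x n) p z = ddir (\<lambda>x. \<beta> c x z) p n"
    using reeb(4)[OF p] by (simp add: ext_deriv_def z_def)
  show ?thesis
    using 1[of n z] 1[of z n] 2[of n] 3[of "ddir (\<zeta> c) p n"] 4 ddir_g_commute[OF p, of n z z]
      g_commute[OF p, of n "ddir (\<zeta> c) p z"]
    by linarith
qed

end


section \<open>Invariant integral submanifolds\<close>

text \<open>\<open>\<sigma>\<close> stands for the inclusion of a leaf, read in a chart of the leaf
  and the chart \<open>c\<close> and defined on their overlap \<open>U\<close>.\<close>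

locale integral_submanifold_in_chart = metric_contact_pair_in_chart c \<alpha> \<beta> \<xi> \<zeta> \<phi> g
  for c :: "('p, 'e::euclidean_space) chart"
    and \<alpha> \<beta> :: "('p, 'e) one_form"
    and \<xi> \<zeta> :: "('p, 'e) vector_field"
    and \<phi> :: "('p, 'e) endomorphism_field"
    and g :: "('p, 'e) two_tensor" +
  fixes U :: "'f::euclidean_space set" and \<sigma> :: "'f \<Rightarrow> 'e"
  assumes open_U: "open U" and smooth_\<sigma>: "smooth_on U \<sigma>"
    and maps: "z \<in> U \<Longrightarrow> \<sigma> z \<in> chart_image c"
    and inj_ddir: "z \<in> U \<Longrightarrow> inj (ddir \<sigma> z)"
    and tangent: "z \<in> U \<Longrightarrow> range (ddir \<sigma> z) = characteristic_distribution \<alpha> c (\<sigma> z)"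
    and invariant: "x \<in> chart_image c \<Longrightarrow>
      \<phi> c x ` characteristic_distribution \<alpha> c x \<subseteq> characteristic_distribution \<alpha> c x"
begin

section \<open>Derivatives of tangent fields along the submanifold\<close>

lemma \<sigma>_differentiable:
  assumes "y \<in> U"
  shows "\<sigma> differentiable at y" "(\<lambda>z. ddir \<sigma> z v) differentiable at y"
  using assms smooth_\<sigma> smooth_on_ddir smooth_on_imp_differentiable by blast+

lemma ddir_\<sigma>_linear: "y \<in> U \<Longrightarrow> linear (ddir \<sigma> y)"
  using linear_frechet_derivative[OF \<sigma>_differentiable(1)] .

lemma ddir_\<sigma>_tangent: "y \<in> U \<Longrightarrow> ddir \<sigma> y v \<in> characteristic_distribution \<alpha> c (\<sigma> y)"
  using tangent by blast

text \<open>The distribution is cut out by equations linear in the vector. When such an equation for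
  \<open>V\<close> is differentiated at a zero of \<open>V\<close>, the derivative of its
  coefficients contributes nothing, so \<open>ddir V y u\<close> satisfies the same
  equation.\<close>

lemma tangent_field_ddir_tangent_of_zero:
  assumes y: "y \<in> U" and V: "V differentiable at y" "V y = 0"
    and tan: "\<And>z. z \<in> U \<Longrightarrow> V z \<in> characteristic_distribution \<alpha> c (\<sigma> z)"
  shows "ddir V y u \<in> characteristic_distribution \<alpha> c (\<sigma> y)"
proof -
  note p = maps[OF y]
  \<comment> \<open>One equation at a time: \<open>\<alpha>\<close> first, then
    \<open>ext_deriv \<alpha>\<close> with its second argument \<open>w\<close> held fixed.\<close>
  have *: "a (\<sigma> y) (ddir V y u) = 0"
    if a: "\<And>x. x \<in> chart_image c \<Longrightarrow> linear (a x)" "\<And>v. (\<lambda>x. a x v) differentiable at (\<sigma> y)"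
      and 0: "\<And>z. z \<in> U \<Longrightarrow> a (\<sigma> z) (V z) = 0" for a :: "'e \<Rightarrow> 'e \<Rightarrow> real"
  proof -
    note d = ddir_apply_linear[OF open_chart p a open_U y maps refl \<sigma>_differentiable(1)[OF y] V(1)]
    have "ddir (\<lambda>x. a x (V y)) (\<sigma> y) (ddir \<sigma> y u) = 0"
      unfolding V(2) by (rule linear_0[OF linear_ddir_apply[OF open_chart p a]])
    then have "ddir (\<lambda>z. a (\<sigma> z) (V z)) y u = a (\<sigma> y) (ddir V y u)"
      using d(2) by simp
    moreover have "ddir (\<lambda>z. a (\<sigma> z) (V z)) y u = ddir (\<lambda>z. 0) y u"
      by (rule ddir_cong_open[OF open_U y d(1) 0])
    ultimately show ?thesis by simp
  qed
  have "\<alpha> c (\<sigma> y) (ddir V y u) = 0"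
    by (rule *[of "\<alpha> c"])
       (use fields_linear(1) fields_differentiable(1)[OF p] tan in \<open>auto simp: characteristic_distribution_def\<close>)
  moreover have "ext_deriv \<alpha> c (\<sigma> y) (ddir V y u) w = 0" for w
  proof (rule *[of "\<lambda>x v. ext_deriv \<alpha> c x v w"])
    fix x assume x: "x \<in> chart_image c"
    note l = linear_ddir_apply[OF open_chart x fields_linear(1) fields_differentiable(1)[OF x]]
      linear_frechet_derivative[OF fields_differentiable(1)[OF x]]
    show "linear (\<lambda>v. ext_deriv \<alpha> c x v w)"
      unfolding ext_deriv_def
      by (intro linearI)
         (simp_all add: linear_add[OF l(1)] linear_cmul[OF l(1)] linear_add[OF l(2)] linear_cmul[OF l(2)] field_simps)
  next
    show "(\<lambda>x. ext_deriv \<alpha> c x v w) differentiable at (\<sigma> y)" for v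
      unfolding ext_deriv_def by (intro derivative_intros fields_differentiable p) simp
  qed (use tan in \<open>auto simp: characteristic_distribution_def\<close>)
  ultimately show ?thesis by (simp add: characteristic_distribution_def)
qed

text \<open>Tensoriality of the second fundamental form: in normal directions, the derivative of a
  constant-component field may be replaced by that of any tangent field with the same value at
  \<open>y\<close>.\<close>

lemma tangent_field_ddir:
  assumes y: "y \<in> U" and W: "W differentiable at y" "W y = ddir \<sigma> y w"
    and tan: "\<And>z. z \<in> U \<Longrightarrow> W z \<in> characteristic_distribution \<alpha> c (\<sigma> z)"
  shows "ddir W y u - ddir (\<lambda>z. ddir \<sigma> z w) y u \<in> characteristic_distribution \<alpha> c (\<sigma> y)"
proof -
  have "W z - ddir \<sigma> z w \<in> characteristic_distribution \<alpha> c (\<sigma> z)" if "z \<in> U" for z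
    using tan[OF that] subspace_diff[OF linear_subspace_image[OF ddir_\<sigma>_linear[OF that] subspace_UNIV]]
    unfolding tangent[OF that, symmetric] by blast
  moreover have "(\<lambda>z. W z - ddir \<sigma> z w) differentiable at y"
    by (intro derivative_intros W(1) \<sigma>_differentiable y)
  ultimately have "ddir (\<lambda>z. W z - ddir \<sigma> z w) y u \<in> characteristic_distribution \<alpha> c (\<sigma> y)"
    using W(2) by (intro tangent_field_ddir_tangent_of_zero y) auto
  moreover have "ddir (\<lambda>z. W z - ddir \<sigma> z w) y u = ddir W y u - ddir (\<lambda>z. ddir \<sigma> z w) y u"
    by (rule ddir_eq[OF has_derivative_diff]) (rule has_derivative_ddir W(1) \<sigma>_differentiable y)+
  ultimately show ?thesis by simp
qed

lemma second_derivative_\<sigma>_symmetric: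
  assumes "y \<in> U"
  shows "ddir (\<lambda>z. ddir \<sigma> z v) y u = ddir (\<lambda>z. ddir \<sigma> z u) y v"
  by (rule second_derivative_symmetric[OF open_U assms smooth_\<sigma>])

lemma second_derivative_\<sigma>_linear:
  assumes y: "y \<in> U"
  shows "linear (\<lambda>u. ddir (\<lambda>z. ddir \<sigma> z v) y u)" "linear (\<lambda>v. ddir (\<lambda>z. ddir \<sigma> z v) y u)"
proof -
  show *: "linear (\<lambda>u. ddir (\<lambda>z. ddir \<sigma> z v) y u)" for v
    by (rule linear_frechet_derivative[OF \<sigma>_differentiable(2)[OF y]])
  show "linear (\<lambda>v. ddir (\<lambda>z. ddir \<sigma> z v) y u)"
    unfolding second_derivative_\<sigma>_symmetric[OF y, of _ u] by (rule *)
qed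

section \<open>The induced metric and the second fundamental form against a normal vector\<close>

lemma induced_inner_product:
  assumes y: "y \<in> U"
  shows "inner_product (\<lambda>u v. g c (\<sigma> y) (ddir \<sigma> y u) (ddir \<sigma> y v))"
  unfolding inner_product_def bilinear_def
proof (intro conjI allI impI)
  note p = maps[OF y]
  note L = ddir_\<sigma>_linear[OF y]
  show "linear (\<lambda>v. g c (\<sigma> y) (ddir \<sigma> y u) (ddir \<sigma> y v))" for u
    using linear_compose[OF L g_linear(1)[OF p]] by (simp add: comp_def)
  show "linear (\<lambda>u. g c (\<sigma> y) (ddir \<sigma> y u) (ddir \<sigma> y v))" for v
    using linear_compose[OF L g_linear(2)[OF p]] by (simp add: comp_def)
  show "g c (\<sigma> y) (ddir \<sigma> y u) (ddir \<sigma> y v) = g c (\<sigma> y) (ddir \<sigma> y v) (ddir \<sigma> y u)" for u v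
    by (rule g_commute[OF p])
  show "0 < g c (\<sigma> y) (ddir \<sigma> y v) (ddir \<sigma> y v)" if "v \<noteq> 0" for v
  proof -
    have "ddir \<sigma> y v \<noteq> 0" using inj_ddir[OF y] that linear_0[OF L] by (metis injD)
    then show ?thesis using metric[OF p] by (simp add: inner_product_def)
  qed
qed

text \<open>
  For \<open>n\<close> normal to the submanifold, the trace of this form is that of \<open>g(II(u,u),n)\<close>, with
  the Christoffel map expanded by Koszul's formula.
\<close>

definition normal_component :: "'f \<Rightarrow> 'e \<Rightarrow> 'f \<Rightarrow> 'f \<Rightarrow> real" where
  "normal_component y n u v =
     g c (\<sigma> y) (ddir (\<lambda>z. ddir \<sigma> z v) y u) n + ddir (\<lambda>x. g c x (ddir \<sigma> y v) n) (\<sigma> y) (ddir \<sigma> y u)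
       - ddir (\<lambda>x. g c x (ddir \<sigma> y u) (ddir \<sigma> y v)) (\<sigma> y) n / 2"

lemma normal_component_bilinear:
  assumes y: "y \<in> U"
  shows "bilinear (normal_component y n)"
proof -
  note p = maps[OF y]
  note L = ddir_\<sigma>_linear[OF y] and B = second_derivative_\<sigma>_linear[OF y]
    and G = g_linear(2)[OF p] and D = ddir_g_linear[OF p]
  note lin = linear_add[OF L] linear_cmul[OF L] linear_add[OF G] linear_cmul[OF G]
    linear_add[OF B(1)] linear_cmul[OF B(1)] linear_add[OF B(2)] linear_cmul[OF B(2)]
    linear_add[OF D(1)] linear_cmul[OF D(1)] linear_add[OF D(2)] linear_cmul[OF D(2)]
    linear_add[OF D(3)] linear_cmul[OF D(3)]
  show ?thesis
    unfolding bilinear_def normal_component_def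
    by (intro conjI allI linearI; simp only: lin; simp add: field_simps)
qed

context
  fixes y n
  assumes y: "y \<in> U" and normal: "\<And>v. g c (\<sigma> y) n (ddir \<sigma> y v) = 0"
begin

lemma normal_tangent_0:
  assumes "t \<in> characteristic_distribution \<alpha> c (\<sigma> y)"
  shows "g c (\<sigma> y) t n = 0"
  using assms normal g_commute[OF maps[OF y]] unfolding tangent[OF y, symmetric] by auto

lemma \<phi>_tangent: "\<phi> c (\<sigma> y) (ddir \<sigma> y v) \<in> characteristic_distribution \<alpha> c (\<sigma> y)"
  using invariant[OF maps[OF y]] ddir_\<sigma>_tangent[OF y] by blast

lemma \<alpha>_tangent: "\<alpha> c (\<sigma> y) (ddir \<sigma> y v) = 0"
  using ddir_\<sigma>_tangent[OF y] by (simp add: characteristic_distribution_def)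

lemma \<zeta>_tangent:
  assumes "x \<in> chart_image c"
  shows "\<zeta> c x \<in> characteristic_distribution \<alpha> c x"
  using reeb(2,3)[OF assms] by (simp add: characteristic_distribution_def)

lemma \<beta>_normal_0: "\<beta> c (\<sigma> y) n = 0"
  using normal_tangent_0[OF \<zeta>_tangent[OF maps[OF y]]] g_reeb(2)[OF maps[OF y]] g_commute[OF maps[OF y]]
  by metis

text \<open>A skew map preserving the tangent space also preserves its orthogonal complement; the
  image of \<open>n\<close> thus becomes available as a second normal vector.\<close>

lemma \<phi>_normal: "g c (\<sigma> y) (\<phi> c (\<sigma> y) n) (ddir \<sigma> y v) = 0"
  using normal_tangent_0[OF \<phi>_tangent] \<phi>_skew[OF maps[OF y]] g_commute[OF maps[OF y]] by simp

end

text \<open>The derivative along the submanifold of the fact that \<open>\<phi>\<close> preserves its tangent spaces.\<close>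

lemma second_derivative_\<phi>:
  assumes y: "y \<in> U" and normal: "\<And>v. g c (\<sigma> y) n (ddir \<sigma> y v) = 0"
    and w: "ddir \<sigma> y w = \<phi> c (\<sigma> y) (ddir \<sigma> y v)"
  shows "g c (\<sigma> y) (ddir (\<lambda>z. ddir \<sigma> z w) y u) n =
    g c (\<sigma> y) (ddir (\<lambda>x. \<phi> c x (ddir \<sigma> y v)) (\<sigma> y) (ddir \<sigma> y u)) n
      - g c (\<sigma> y) (ddir (\<lambda>z. ddir \<sigma> z v) y u) (\<phi> c (\<sigma> y) n)"
proof -
  note p = maps[OF y]
  note d = ddir_apply_linear[OF open_chart p fields_linear(3) fields_differentiable(5)[OF p] open_U y maps refl
      \<sigma>_differentiable(1)[OF y] \<sigma>_differentiable(2)[OF y, of v]]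
  \<comment> \<open>The image under \<open>\<phi>\<close> of the field given by \<open>v\<close> is
    tangent by invariance and has the value \<open>ddir \<sigma> y w\<close> at
    \<open>y\<close>.\<close>
  have "ddir (\<lambda>z. \<phi> c (\<sigma> z) (ddir \<sigma> z v)) y u - ddir (\<lambda>z. ddir \<sigma> z w) y u
      \<in> characteristic_distribution \<alpha> c (\<sigma> y)"
    by (rule tangent_field_ddir[OF y d(1) w[symmetric]]) (auto intro!: subsetD[OF invariant[OF maps] imageI[OF ddir_\<sigma>_tangent]])
  note tan = normal_tangent_0[OF y normal this]
  have "ddir (\<lambda>z. \<phi> c (\<sigma> z) (ddir \<sigma> z v)) y u =
      ddir (\<lambda>x. \<phi> c x (ddir \<sigma> y v)) (\<sigma> y) (ddir \<sigma> y u) + \<phi> c (\<sigma> y) (ddir (\<lambda>z. ddir \<sigma> z v) y u)"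
    using d(2) by simp
  from tan[unfolded this] show ?thesis
    unfolding linear_diff[OF g_linear(2)[OF p]] linear_add[OF g_linear(2)[OF p]] \<phi>_skew[OF p] by simp
qed

text \<open>This is II(X, X) + II(\<phi> X, \<phi> X) = 0 paired with \<open>n\<close>. Two uses of
  \<open>second_derivative_\<phi>\<close>, with \<open>n\<close> and with its image under
  \<open>\<phi>\<close>, relate the second derivative of \<open>\<sigma>\<close> in
  \<open>w\<close>, \<open>w\<close> to minus that in \<open>v\<close>, \<open>v\<close>; what is
  left over is \<open>horizontal_identity\<close>.\<close>

lemma normal_component_horizontal:
  assumes y: "y \<in> U" and normal: "\<And>v. g c (\<sigma> y) n (ddir \<sigma> y v) = 0"
    and w: "ddir \<sigma> y w = \<phi> c (\<sigma> y) (ddir \<sigma> y v)" and v: "\<beta> c (\<sigma> y) (ddir \<sigma> y v) = 0"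
  shows "normal_component y n v v + normal_component y n w w = 0"
proof -
  note p = maps[OF y]
  note \<beta>n = \<beta>_normal_0[OF y normal] and \<phi>n = \<phi>_normal[OF y normal]
    and \<alpha>v = \<alpha>_tangent[OF y normal]
  define B where "B u v = ddir (\<lambda>z. ddir \<sigma> z v) y u" for u v
  have 1: "g c (\<sigma> y) (B w w) n =
      g c (\<sigma> y) (ddir (\<lambda>x. \<phi> c x (ddir \<sigma> y v)) (\<sigma> y) (ddir \<sigma> y w)) n - g c (\<sigma> y) (B w v) (\<phi> c (\<sigma> y) n)"
    unfolding B_def by (rule second_derivative_\<phi>[OF y normal w])
  have 2: "g c (\<sigma> y) (B v w) (\<phi> c (\<sigma> y) n) =
      g c (\<sigma> y) (ddir (\<lambda>x. \<phi> c x (ddir \<sigma> y v)) (\<sigma> y) (ddir \<sigma> y v)) (\<phi> c (\<sigma> y) n)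
      - g c (\<sigma> y) (B v v) (\<phi> c (\<sigma> y) (\<phi> c (\<sigma> y) n))"
    unfolding B_def by (rule second_derivative_\<phi>[OF y \<phi>n w])
  have 3: "B w v = B v w" unfolding B_def by (rule second_derivative_\<sigma>_symmetric[OF y])
  have 4: "g c (\<sigma> y) (B v v) (\<phi> c (\<sigma> y) (\<phi> c (\<sigma> y) n)) =
      - g c (\<sigma> y) (B v v) n + \<alpha> c (\<sigma> y) n * \<alpha> c (\<sigma> y) (B v v)"
    unfolding \<phi>_\<phi>[OF p] \<beta>n linear_add[OF g_linear(1)[OF p]] linear_neg[OF g_linear(1)[OF p]]
      linear_cmul[OF g_linear(1)[OF p]] g_reeb[OF p] by simp
  \<comment> \<open>The derivative along \<open>\<sigma>\<close> of the vanishing of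
    \<open>\<alpha>\<close> on tangent vectors; it accounts for the \<open>\<xi>\<close> component
    of \<phi> (\<phi> n) in \<open>4\<close>.\<close>
  have 5: "ddir (\<lambda>x. \<alpha> c x (ddir \<sigma> y v)) (\<sigma> y) (ddir \<sigma> y v) = - \<alpha> c (\<sigma> y) (B v v)"
  proof -
    note d = ddir_apply_linear[OF open_chart p fields_linear(1) fields_differentiable(1)[OF p] open_U y maps refl
        \<sigma>_differentiable(1)[OF y] \<sigma>_differentiable(2)[OF y, of v]]
    have "ddir (\<lambda>z. \<alpha> c (\<sigma> z) (ddir \<sigma> z v)) y v = ddir (\<lambda>z. 0) y v"
      by (rule ddir_cong_open[OF open_U y d(1)])
         (use ddir_\<sigma>_tangent in \<open>auto simp: characteristic_distribution_def\<close>)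
    then show ?thesis using d(2) by (simp add: B_def)
  qed
  show ?thesis
    using horizontal_identity[OF p \<alpha>v v \<beta>n, folded w] 1 2 4
    unfolding normal_component_def B_def[symmetric] 3 5 by simp
qed

text \<open>\<open>\<zeta>\<close> along \<open>\<sigma>\<close> and the field given by
  \<open>w\<close> are both tangent and agree at \<open>y\<close>; exchanging them reduces the claim
  to \<open>reeb_identity\<close>.\<close>

lemma normal_component_reeb:
  assumes y: "y \<in> U" and normal: "\<And>v. g c (\<sigma> y) n (ddir \<sigma> y v) = 0"
    and w: "ddir \<sigma> y w = \<zeta> c (\<sigma> y)"
  shows "normal_component y n w w = 0"
proof -
  note p = maps[OF y]
  have comp: "((\<lambda>z. \<zeta> c (\<sigma> z)) has_derivative (\<lambda>u. ddir (\<zeta> c) (\<sigma> y) (ddir \<sigma> y u))) (at y)"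
    by (rule has_derivative_compose[OF has_derivative_ddir[OF \<sigma>_differentiable(1)[OF y]]
          has_derivative_ddir[OF fields_differentiable(4)[OF p]]])
  have "ddir (\<lambda>z. \<zeta> c (\<sigma> z)) y w - ddir (\<lambda>z. ddir \<sigma> z w) y w \<in> characteristic_distribution \<alpha> c (\<sigma> y)"
    by (rule tangent_field_ddir[OF y])
       (use comp w \<zeta>_tangent[OF y normal] maps in \<open>auto simp: differentiable_def\<close>)
  from normal_tangent_0[OF y normal this]
  have "g c (\<sigma> y) (ddir (\<lambda>z. ddir \<sigma> z w) y w) n = g c (\<sigma> y) (ddir (\<zeta> c) (\<sigma> y) (\<zeta> c (\<sigma> y))) n"
    unfolding ddir_eq[OF comp] linear_diff[OF g_linear(2)[OF p]] w by simp
  then show ?thesis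
    using reeb_identity[OF p, of n] by (simp add: normal_component_def w)
qed

lemma normal_component_trace:
  assumes y: "y \<in> U" and normal: "\<And>v. g c (\<sigma> y) n (ddir \<sigma> y v) = 0"
    and E: "orthonormal_basis (\<lambda>u v. g c (\<sigma> y) (ddir \<sigma> y u) (ddir \<sigma> y v)) E"
  shows "(\<Sum>e\<in>E. normal_component y n e e) = 0"
proof -
  note p = maps[OF y]
  note L = ddir_\<sigma>_linear[OF y]
  \<comment> \<open>\<open>\<phi>\<close> transported to the coordinates of the submanifold;
    invariance places the argument of \<open>inv\<close> in the range of the injective map
    \<open>ddir \<sigma> y\<close>.\<close>
  define J where "J v = inv (ddir \<sigma> y) (\<phi> c (\<sigma> y) (ddir \<sigma> y v))" for v
  have J: "ddir \<sigma> y (J v) = \<phi> c (\<sigma> y) (ddir \<sigma> y v)" for v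
    unfolding J_def using \<phi>_tangent[OF y normal] tangent[OF y] by (auto intro!: f_inv_into_f)
  obtain z where z: "ddir \<sigma> y z = \<zeta> c (\<sigma> y)"
    using \<zeta>_tangent[OF y normal p] tangent[OF y] by (metis imageE)
  have eqI: "u = v" if "ddir \<sigma> y u = ddir \<sigma> y v" for u v
    using inj_ddir[OF y] that by (auto dest: injD)
  show ?thesis
  proof (rule trace_eq_0_if_invariant[OF induced_inner_product[OF y] E normal_component_bilinear[OF y]])
    show "g c (\<sigma> y) (ddir \<sigma> y (J u)) (ddir \<sigma> y v) = - g c (\<sigma> y) (ddir \<sigma> y u) (ddir \<sigma> y (J v))" for u v
      unfolding J by (rule \<phi>_skew[OF p])
    show "J z = 0"
      by (rule eqI) (simp add: J z \<phi>_reeb[OF p] linear_0[OF L])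
    show "J (J u) = - u + g c (\<sigma> y) (ddir \<sigma> y u) (ddir \<sigma> y z) *\<^sub>R z" for u
      by (rule eqI) (simp add: J \<phi>_\<phi>[OF p] \<alpha>_tangent[OF y normal] z g_reeb[OF p]
          linear_diff[OF L] linear_cmul[OF L])
    show "g c (\<sigma> y) (ddir \<sigma> y z) (ddir \<sigma> y z) = 1"
      by (simp add: z g_reeb[OF p] reeb[OF p])
    show "normal_component y n z z = 0"
      by (rule normal_component_reeb[OF y normal z])
    show "normal_component y n u u + normal_component y n (J u) (J u) = 0"
      if "g c (\<sigma> y) (ddir \<sigma> y u) (ddir \<sigma> y z) = 0" for u
      by (rule normal_component_horizontal[OF y normal J]) (use that in \<open>simp add: z g_reeb[OF p]\<close>)
  qed
qed

text \<open>The trace \<open>n\<close> of the second fundamental form is itself normal, hence an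
  admissible test vector; \<open>normal_component_trace\<close> then gives g(n, n) = 0, and
  \<open>g\<close> is definite.\<close>

lemma second_fundamental_form_trace:
  assumes y: "y \<in> U" and \<sigma>: "transition b c = \<sigma>"
    and E: "orthonormal_basis (induced_metric g b c y) E"
  shows "(\<Sum>e\<in>E. second_fundamental_form g b c y e e) = 0"
proof -
  note p = maps[OF y]
  note G = g_linear(2)[OF p]
  define w where "w e = ddir (\<lambda>z. ddir \<sigma> z e) y e + christoffel g c (\<sigma> y) (ddir \<sigma> y e) (ddir \<sigma> y e)" for e
  define N where "N e = second_fundamental_form g b c y e e" for e
  have N: "w e - N e \<in> range (ddir \<sigma> y)" "g c (\<sigma> y) (N e) (ddir \<sigma> y v) = 0" for e v
    using normal_part_spec[OF metric[OF p] ddir_\<sigma>_linear[OF y] induced_inner_product[OF y], of "w e"]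
    by (auto simp: N_def second_fundamental_form_def \<sigma> w_def Let_def)
  define n where "n = (\<Sum>e\<in>E. N e)"
  have n: "g c (\<sigma> y) n (ddir \<sigma> y v) = 0" for v
    unfolding n_def linear_sum[OF G] N by simp
  have "g c (\<sigma> y) (N e) n = normal_component y n e e" for e
  proof -
    have "w e - N e \<in> characteristic_distribution \<alpha> c (\<sigma> y)"
      using N(1) tangent[OF y] by simp
    from normal_tangent_0[OF y n this] have "g c (\<sigma> y) (N e) n = g c (\<sigma> y) (w e) n"
      unfolding linear_diff[OF G] by simp
    \<comment> \<open>For equal arguments the first two Koszul terms coincide, which absorbs their
      factor 1/2.\<close>
    also have "\<dots> = normal_component y n e e"
      unfolding w_def linear_add[OF G] normal_component_def
      by (simp add: christoffel_spec[where g = g and c = c, OF open_chart p metric fields_differentiable(6)[OF p]])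
    finally show ?thesis .
  qed
  moreover have "(\<Sum>e\<in>E. normal_component y n e e) = 0"
    by (rule normal_component_trace[OF y n]) (use E in \<open>simp add: induced_metric_def[abs_def] \<sigma>\<close>)
  ultimately have "g c (\<sigma> y) n n = 0"
    by (subst (1) n_def) (simp add: linear_sum[OF G])
  then show ?thesis
    by (simp add: inner_product_zero_iff[OF metric[OF p]] n_def N_def)
qed

text \<open>The trace vanishes for every orthonormal basis, in particular for the one picked by
  \<open>SOME\<close>, since such a basis exists.\<close>

lemma mean_curvature_eq_0:
  assumes y: "y \<in> U" and \<sigma>: "transition b c = \<sigma>"
  shows "mean_curvature g b c y = 0"
proof -
  have "induced_metric g b c y = (\<lambda>u v. g c (\<sigma> y) (ddir \<sigma> y u) (ddir \<sigma> y v))"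
    by (simp add: induced_metric_def[abs_def] \<sigma>)
  then have "\<exists>E. orthonormal_basis (induced_metric g b c y) E"
    using orthonormal_basis_exists[OF induced_inner_product[OF y]] by simp
  from second_fundamental_form_trace[OF y \<sigma> someI_ex[OF this]] show ?thesis
    by (simp add: mean_curvature_def)
qed

end

section \<open>From charts to leaves and foliations\<close>

lemma transition_in_chart_image:
  assumes "inj_on (snd b) (fst b)" "z \<in> overlap b c"
  shows "transition b c z \<in> chart_image c"
  using assms by (auto simp: overlap_def transition_def chart_image_def)

text \<open>Minimality is checked chart by chart: a leaf chart \<open>b\<close> and an ambient chart
  \<open>c\<close> form an instance of \<open>integral_submanifold_in_chart\<close>, with
  \<open>transition b c\<close> as \<open>\<sigma>\<close>.\<close>

lemma minimal_characteristic_foliation: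
  fixes A :: "('p, 'e::euclidean_space) chart set"
  assumes chart: "\<And>c. c \<in> A \<Longrightarrow> metric_contact_pair_in_chart c \<alpha> \<beta> \<xi> \<zeta> \<phi> g"
    and invariant: "\<And>c x. c \<in> A \<Longrightarrow> x \<in> chart_image c \<Longrightarrow>
      \<phi> c x ` characteristic_distribution \<alpha> c x \<subseteq> characteristic_distribution \<alpha> c x"
  shows "minimal_foliation A g (characteristic_foliation A \<alpha> :: ('p, 'f::euclidean_space) chart set set)"
  unfolding minimal_foliation_def minimal_submanifold_def
proof (intro ballI conjI)
  fix B :: "('p, 'f) chart set"
  assume "B \<in> characteristic_foliation A \<alpha>"
  then have B: "connected_integral_manifold A (characteristic_distribution \<alpha>) B"
    by (simp add: characteristic_foliation_def leaf_def)
  then show im: "immersed_submanifold A B" by (simp add: connected_integral_manifold_def)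
  fix b c y assume bc: "b \<in> B" "c \<in> A" and y: "y \<in> overlap b c"
  have inj_b: "inj_on (snd b) (fst b)"
    using im bc(1) by (auto simp: immersed_submanifold_def smooth_manifold_def smooth_atlas_def)
  interpret metric_contact_pair_in_chart c \<alpha> \<beta> \<xi> \<zeta> \<phi> g
    by (rule chart[OF bc(2)])
  interpret integral_submanifold_in_chart c \<alpha> \<beta> \<xi> \<zeta> \<phi> g "overlap b c" "transition b c"
  proof unfold_locales
    show "open (overlap b c)" "smooth_on (overlap b c) (transition b c)"
      using im bc by (auto simp: immersed_submanifold_def)
  next
    fix z assume z: "z \<in> overlap b c"
    show "transition b c z \<in> chart_image c"
      by (rule transition_in_chart_image[OF inj_b z])
    show "inj (ddir (transition b c) z)"
      using im bc z by (simp add: immersed_submanifold_def)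
    show "range (ddir (transition b c) z) = characteristic_distribution \<alpha> c (transition b c z)"
      using B bc z by (simp add: connected_integral_manifold_def)
  qed (rule invariant[OF bc(2)])
  show "mean_curvature g b c y = 0" by (rule mean_curvature_eq_0[OF y refl])
qed

theorem theorem3p2:
  fixes A :: "('p, 'e::euclidean_space) chart set"
    and \<alpha>\<^sub>1 \<alpha>\<^sub>2 :: "('p, 'e) one_form"
    and Z\<^sub>1 Z\<^sub>2 :: "('p, 'e) vector_field"
    and \<phi> :: "('p, 'e) endomorphism_field"
    and g :: "('p, 'e) two_tensor"
    and h k :: nat
  assumes "smooth_manifold A"
    and "metric_contact_pair A h k \<alpha>\<^sub>1 \<alpha>\<^sub>2 Z\<^sub>1 Z\<^sub>2 \<phi> g"
    and "decomposable A \<alpha>\<^sub>1 \<alpha>\<^sub>2 \<phi>"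
  shows "minimal_foliation A g (characteristic_foliation A \<alpha>\<^sub>1 :: ('p, 'f\<^sub>1::euclidean_space) chart set set)
       \<and> minimal_foliation A g (characteristic_foliation A \<alpha>\<^sub>2 :: ('p, 'f\<^sub>2::euclidean_space) chart set set)"
proof
  have fields: "smooth_one_form A \<alpha>\<^sub>1" "smooth_one_form A \<alpha>\<^sub>2" "smooth_vector_field A Z\<^sub>1"
      "smooth_vector_field A Z\<^sub>2" "smooth_endomorphism_field A \<phi>" "riemannian_metric A g"
    and reeb: "reeb_fields A \<alpha>\<^sub>1 \<alpha>\<^sub>2 Z\<^sub>1 Z\<^sub>2"
    and cps: "contact_pair_structure A h k \<alpha>\<^sub>1 \<alpha>\<^sub>2 Z\<^sub>1 Z\<^sub>2 \<phi>"
    using assms(2)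
    by (simp_all add: metric_contact_pair_def contact_pair_structure_def contact_pair_def reeb_fields_def)
  note inv = assms(3)[unfolded decomposable_def]
  \<comment> \<open>The locale holds for both orders of the pair, one for each foliation; this is
    why the sums below are stated with their summands in either order.\<close>
  have in_chart: "metric_contact_pair_in_chart c \<alpha>\<^sub>1 \<alpha>\<^sub>2 Z\<^sub>1 Z\<^sub>2 \<phi> g \<and>
      metric_contact_pair_in_chart c \<alpha>\<^sub>2 \<alpha>\<^sub>1 Z\<^sub>2 Z\<^sub>1 \<phi> g" if c: "c \<in> A" for c
  proof -
    have "open (chart_image c)"
      using assms(1) c by (simp add: smooth_manifold_def smooth_atlas_def)
    moreover have "smooth_on (chart_image c) (\<lambda>x. \<alpha>\<^sub>1 c x v)" "smooth_on (chart_image c) (\<lambda>x. \<alpha>\<^sub>2 c x v)"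
      "smooth_on (chart_image c) (Z\<^sub>1 c)" "smooth_on (chart_image c) (Z\<^sub>2 c)"
      "smooth_on (chart_image c) (\<lambda>x. \<phi> c x v)" "smooth_on (chart_image c) (\<lambda>x. g c x u v)" for u v
      using fields c by (simp_all add: smooth_one_form_def smooth_vector_field_def
          smooth_endomorphism_field_def riemannian_metric_def)
    moreover have "linear (\<alpha>\<^sub>1 c x)" "linear (\<alpha>\<^sub>2 c x)" "linear (\<phi> c x)" "inner_product (g c x)"
      if "x \<in> chart_image c" for x
      using fields c that by (simp_all add: smooth_one_form_def smooth_endomorphism_field_def riemannian_metric_def)
    moreover have "\<alpha>\<^sub>1 c x (Z\<^sub>1 c x) = 1" "\<alpha>\<^sub>2 c x (Z\<^sub>2 c x) = 1" "\<alpha>\<^sub>1 c x (Z\<^sub>2 c x) = 0" "\<alpha>\<^sub>2 c x (Z\<^sub>1 c x) = 0"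
      "ext_deriv \<alpha>\<^sub>1 c x (Z\<^sub>1 c x) v = 0" "ext_deriv \<alpha>\<^sub>2 c x (Z\<^sub>1 c x) v = 0"
      "ext_deriv \<alpha>\<^sub>1 c x (Z\<^sub>2 c x) v = 0" "ext_deriv \<alpha>\<^sub>2 c x (Z\<^sub>2 c x) v = 0"
      if "x \<in> chart_image c" for x v
      using reeb c that by (simp_all add: reeb_fields_def)
    moreover have "\<phi> c x (\<phi> c x v) = - v + \<alpha>\<^sub>1 c x v *\<^sub>R Z\<^sub>1 c x + \<alpha>\<^sub>2 c x v *\<^sub>R Z\<^sub>2 c x"
      "\<phi> c x (\<phi> c x v) = - v + \<alpha>\<^sub>2 c x v *\<^sub>R Z\<^sub>2 c x + \<alpha>\<^sub>1 c x v *\<^sub>R Z\<^sub>1 c x"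
      "\<phi> c x (Z\<^sub>1 c x) = 0" "\<phi> c x (Z\<^sub>2 c x) = 0"
      if "x \<in> chart_image c" for x v
      using cps c that by (simp_all add: contact_pair_structure_def add_ac)
    moreover have "g c x u (\<phi> c x v) = ext_deriv \<alpha>\<^sub>1 c x u v + ext_deriv \<alpha>\<^sub>2 c x u v"
      "g c x u (\<phi> c x v) = ext_deriv \<alpha>\<^sub>2 c x u v + ext_deriv \<alpha>\<^sub>1 c x u v"
      "g c x u (Z\<^sub>1 c x) = \<alpha>\<^sub>1 c x u" "g c x u (Z\<^sub>2 c x) = \<alpha>\<^sub>2 c x u"
      if "x \<in> chart_image c" for x u v
      using assms(2) c that by (simp_all add: metric_contact_pair_def add.commute)
    ultimately show ?thesis
      unfolding metric_contact_pair_in_chart_def by blast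
  qed
  show "minimal_foliation A g (characteristic_foliation A \<alpha>\<^sub>1 :: ('p, 'f\<^sub>1) chart set set)"
    and "minimal_foliation A g (characteristic_foliation A \<alpha>\<^sub>2 :: ('p, 'f\<^sub>2) chart set set)"
    by (rule minimal_characteristic_foliation; use in_chart inv in blast)+
qed

end
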